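(* Let $k\ge 0$ and $\varepsilon\in\{0,1,2\}$ be integers with $d=3k+\varepsilon\ge 1$. Put $$\ell=\tfrac{1}{2}(3k+5+2\varepsilon)k+1+\varepsilon,\qquad p=(k+1)\,\delta_{2,\varepsilon},$$ where $\delta_{2,\varepsilon}$ is the Kronecker symbol ($1$ if $\varepsilon=2$, $0$ otherwise). Let $Y=Y(\ell,p)\subset\mathbb{P}^3$ be the reduced subscheme consisting of $\ell$ general lines together with $p$ general points lying on one further line $L_0$, where $L_0$ is general with respect to the $\ell$ lines (the line $L_0$ itself is not part of $Y$). Then the restriction map $$H^0(\mathbb{P}^3,\mathcal{O}_{\mathbb{P}^3}(d))\longrightarrow H^0(Y,\mathcal{O}_{Y}(d))$$ is an isomorphism.
   Context: We work over an algebraically closed field (of characteristic zero). "General" means that the configuration lies in a suitable dense Zariski-open subset of the relevant parameter space (products of Grassmannians of lines, of points on a line, etc.). The numbers $\ell,p$ are chosen so that both sides of the restriction map have the same dimension $\binom{d+3}{3}$. *)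

theory Defs
  imports Main
begin

class alg_closed_char0 = field_char_0 +
  assumes alg_closed: "0 < n \<Longrightarrow> c n \<noteq> 0 \<Longrightarrow> \<exists>x. (\<Sum>i\<le>n. c i * x ^ i) = 0"

text \<open>Homogeneous forms of degree d in 4 variables x_0..x_3, given by coefficient
  functions on exponent vectors (exponent vectors are nat => nat supported in {0..3}).\<close>
definition mons :: "nat \<Rightarrow> (nat \<Rightarrow> nat) set" where
  "mons d = {\<alpha>. (\<forall>i\<ge>4. \<alpha> i = 0) \<and> sum \<alpha> {0..<4} = d}"

definition forms :: "nat \<Rightarrow> ((nat \<Rightarrow> nat) \<Rightarrow> 'a::field) set" where
  "forms d = {c. \<forall>\<alpha>. \<alpha> \<notin> mons d \<longrightarrow> c \<alpha> = 0}"

definition evalF :: "nat \<Rightarrow> ((nat \<Rightarrow> nat) \<Rightarrow> 'a::field) \<Rightarrow> (nat \<Rightarrow> 'a) \<Rightarrow> 'a" where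
  "evalF d c x = (\<Sum>\<alpha>\<in>mons d. c \<alpha> * (\<Prod>i<4. x i ^ \<alpha> i))"

text \<open>Binary forms of degree d (= H^0(P^1, O(d))), as functions of (s,t).\<close>
definition binforms :: "nat \<Rightarrow> ('a::field \<times> 'a \<Rightarrow> 'a) set" where
  "binforms d = {g. \<exists>\<beta>. g = (\<lambda>(s,t). \<Sum>j\<le>d. \<beta> j * s ^ j * t ^ (d - j))}"

text \<open>Parameters of a configuration: line i (i < l) spanned by vectors VA i _ and VB i _;
  the line L_0 spanned by VC _ and VE _; the j-th point on L_0 is VU j * C + VV j * E.\<close>
datatype pvar = VA nat nat | VB nat nat | VC nat | VE nat | VU nat | VV nat

inductive poly_fun :: "(('v \<Rightarrow> 'a::comm_ring_1) \<Rightarrow> 'a) \<Rightarrow> bool" where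
  pf_const: "poly_fun (\<lambda>z. c)"
| pf_var: "poly_fun (\<lambda>z. z v)"
| pf_add: "poly_fun f \<Longrightarrow> poly_fun g \<Longrightarrow> poly_fun (\<lambda>z. f z + g z)"
| pf_mult: "poly_fun f \<Longrightarrow> poly_fun g \<Longrightarrow> poly_fun (\<lambda>z. f z * g z)"

text \<open>A property holds for a general configuration: it holds on a nonempty
  Zariski-open subset D(G) of parameter space.\<close>
definition general :: "((pvar \<Rightarrow> 'a::comm_ring_1) \<Rightarrow> bool) \<Rightarrow> bool" where
  "general P \<longleftrightarrow> (\<exists>G. poly_fun G \<and> (\<exists>z. G z \<noteq> 0) \<and> (\<forall>z. G z \<noteq> 0 \<longrightarrow> P z))"

definition line_vec :: "(pvar \<Rightarrow> 'a::field) \<Rightarrow> nat \<Rightarrow> 'a \<Rightarrow> 'a \<Rightarrow> nat \<Rightarrow> 'a" where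
  "line_vec z i s t = (\<lambda>m. s * z (VA i m) + t * z (VB i m))"

definition point_vec :: "(pvar \<Rightarrow> 'a::field) \<Rightarrow> nat \<Rightarrow> nat \<Rightarrow> 'a" where
  "point_vec z j = (\<lambda>m. z (VU j) * z (VC m) + z (VV j) * z (VE m))"

text \<open>Restriction map H^0(P^3,O(d)) -> H^0(Y,O_Y(d)) = (+)_{i<l} H^0(L_i,O(d)) (+) k^p.\<close>
definition restr_map :: "nat \<Rightarrow> nat \<Rightarrow> nat \<Rightarrow> (pvar \<Rightarrow> 'a::field) \<Rightarrow> ((nat \<Rightarrow> nat) \<Rightarrow> 'a)
     \<Rightarrow> (nat \<Rightarrow> 'a \<times> 'a \<Rightarrow> 'a) \<times> (nat \<Rightarrow> 'a)" where
  "restr_map d l p z c =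
     ((\<lambda>i. if i < l then (\<lambda>(s,t). evalF d c (line_vec z i s t)) else (\<lambda>_. 0)),
      (\<lambda>j. if j < p then evalF d c (point_vec z j) else 0))"

definition restr_target :: "nat \<Rightarrow> nat \<Rightarrow> nat \<Rightarrow> ((nat \<Rightarrow> 'a::field \<times> 'a \<Rightarrow> 'a) \<times> (nat \<Rightarrow> 'a)) set" where
  "restr_target d l p = {(g, v). (\<forall>i<l. g i \<in> binforms d) \<and> (\<forall>i\<ge>l. g i = (\<lambda>_. 0)) \<and> (\<forall>j\<ge>p. v j = 0)}"

end

theory Submission
  imports Defs "HOL-Computational_Algebra.Polynomial"
begin

text \<open>
  It suffices to find one configuration for which only the zero form vanishes on it: triviality of
  the kernel is an open condition, and both sides have the same dimension. All lines are spanned by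
  two points of the quadric \<open>x\<^sub>0 x\<^sub>3 = x\<^sub>1 x\<^sub>2\<close>. If some of the lines are specialised to
  members of one ruling, then a form vanishing on the configuration restricts to a form of bidegree
  (d, d) which vanishes on these rulings and in the points where the other lines meet the quadric.
  When this forces the restriction to be zero, the form is a multiple of the quadric, and the
  cofactor of degree d - 2 vanishes on the remaining lines.

  This leads from degree \<open>3 k - 2\<close> to \<open>3 k\<close> and from \<open>3 k\<close> to \<open>3 k + 2\<close>. To reach degree
  \<open>3 k + 1\<close>, let \<open>3 k\<close> of the lines degenerate to \<open>k\<close> chains of three lines whose nodes lie on the
  quadric. In the limit each node becomes a double point of the trace and an ordinary node of the
  residual configuration in degree \<open>3 k - 1\<close>. There the outer lines of the chains are specialised to
  rulings, which leaves general lines in degree \<open>3 k - 3\<close>.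
\<close>

text \<open>All counts are exact, and divisibility dictates the cases. In degree d the right number
  of lines is (d + 2)(d + 3)/6, which is not an integer when d = 2 modulo 3. On the way from 3 k to
  3 k + 2 the trace therefore lacks k + 1 points; they are put on one line of the quadric, which
  plays the role of L_0. On the way from 3 k - 1 to 3 k + 1 the residual configuration has to be
  corrected instead: M + 2 k lines with 2 k nodes impose 3 k (M + 2 k) - 2 k conditions, which
  equals the binomial coefficient (3 k + 2 over 3) for 2 M = 3 k^2 - k + 2. In the trace each node
  counts three times, and 2 M + 6 k = (k + 1)(3 k + 2) is what k + 1 free columns require. The same
  configuration has to be general for the trace and for the residual problem. The ends of the lines
  on the quadric are free parameters in one affine space, and each requirement is open there, so
  each may be checked in a special position of its own.\<close>

section \<open>Polynomial functions and generic properties\<close>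

text \<open>The index type is arbitrary because openness is used over quadric coordinates as well as
  over \<open>pvar\<close>, where this is \<open>general\<close>.\<close>

definition generic :: "(('v \<Rightarrow> 'a::comm_ring_1) \<Rightarrow> bool) \<Rightarrow> bool" where
  "generic P \<longleftrightarrow> (\<exists>G. poly_fun G \<and> (\<exists>z. G z \<noteq> 0) \<and> (\<forall>z. G z \<noteq> 0 \<longrightarrow> P z))"

lemma poly_fun_diff:
  assumes "poly_fun f" "poly_fun g"
  shows "poly_fun (\<lambda>z. f z - g z)"
proof -
  have "poly_fun (\<lambda>z. f z + (-1) * g z)"
    by (intro poly_fun.intros assms)
  then show ?thesis by simp
qed

lemma poly_fun_power: "poly_fun f \<Longrightarrow> poly_fun (\<lambda>z. f z ^ n)"
  by (induction n) (auto intro: poly_fun.intros)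

lemma poly_fun_sum: "(\<And>i. i \<in> A \<Longrightarrow> poly_fun (f i)) \<Longrightarrow> poly_fun (\<lambda>z. \<Sum>i\<in>A. f i z)"
  by (induction A rule: infinite_finite_induct) (auto intro: poly_fun.intros)

lemma poly_fun_prod: "(\<And>i. i \<in> A \<Longrightarrow> poly_fun (f i)) \<Longrightarrow> poly_fun (\<lambda>z. \<Prod>i\<in>A. f i z)"
  by (induction A rule: infinite_finite_induct) (auto intro: poly_fun.intros)

lemmas poly_fun_intros =
  poly_fun.intros poly_fun_diff poly_fun_power poly_fun_sum poly_fun_prod

text \<open>There may be infinitely many variables; on a parametrised line only one is left.\<close>

lemma poly_fun_on_line:
  fixes G :: "('v \<Rightarrow> 'a::comm_ring_1) \<Rightarrow> 'a"
  assumes "poly_fun G"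
  shows "\<exists>p. \<forall>t. poly p t = G (\<lambda>v. z v + t * y v)"
  using assms
proof induction
  case (pf_const c)
  show ?case by (rule exI[of _ "[:c:]"]) simp
next
  case (pf_var v)
  show ?case by (rule exI[of _ "[:z v, y v:]"]) simp
next
  case (pf_add f g)
  then obtain p q where "\<forall>t. poly p t = f (\<lambda>v. z v + t * y v)"
    and "\<forall>t. poly q t = g (\<lambda>v. z v + t * y v)" by blast
  then show ?case by (intro exI[of _ "p + q"]) simp
next
  case (pf_mult f g)
  then obtain p q where "\<forall>t. poly p t = f (\<lambda>v. z v + t * y v)"
    and "\<forall>t. poly q t = g (\<lambda>v. z v + t * y v)" by blast
  then show ?case by (intro exI[of _ "p * q"]) simp
qed

text \<open>Irreducibility of affine space: on the line joining the two witnesses both functions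
  become nonzero univariate polynomials, whose product has finitely many roots in an infinite
  field.\<close>

lemma poly_fun_common_nonzero:
  fixes G H :: "('v \<Rightarrow> 'a::field_char_0) \<Rightarrow> 'a"
  assumes G: "poly_fun G" "G z \<noteq> 0" and H: "poly_fun H" "H y \<noteq> 0"
  shows "\<exists>w. G w \<noteq> 0 \<and> H w \<noteq> 0"
proof -
  obtain p where p: "\<And>t. poly p t = G (\<lambda>v. z v + t * (y v - z v))"
    using poly_fun_on_line[OF G(1), of z "\<lambda>v. y v - z v"] by blast
  obtain q where q: "\<And>t. poly q t = H (\<lambda>v. z v + t * (y v - z v))"
    using poly_fun_on_line[OF H(1), of z "\<lambda>v. y v - z v"] by blast
  have "poly p 0 \<noteq> 0" "poly q 1 \<noteq> 0" using G(2) H(2) by (simp_all add: p q)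
  then have "p * q \<noteq> 0" by auto
  then have "finite {t. poly (p * q) t = 0}" by (rule poly_roots_finite)
  then obtain t where "poly (p * q) t \<noteq> 0"
    using infinite_UNIV_char_0[where 'a='a] by (metis (mono_tags, lifting) UNIV_eq_I mem_Collect_eq)
  then show ?thesis by (auto simp: p q)
qed

lemma genericI: "poly_fun G \<Longrightarrow> G z \<noteq> 0 \<Longrightarrow> (\<And>z. G z \<noteq> 0 \<Longrightarrow> P z) \<Longrightarrow> generic P"
  unfolding generic_def by blast

lemma generic_witness: "generic P \<Longrightarrow> \<exists>z. P z"
  unfolding generic_def by blast

lemma generic_conj:
  fixes P Q :: "('v \<Rightarrow> 'a::field_char_0) \<Rightarrow> bool"
  assumes "generic P" "generic Q"
  shows "generic (\<lambda>z. P z \<and> Q z)"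
proof -
  obtain G z H y where G: "poly_fun G" "G z \<noteq> 0" "\<And>z. G z \<noteq> 0 \<Longrightarrow> P z"
    and H: "poly_fun H" "H y \<noteq> 0" "\<And>z. H z \<noteq> 0 \<Longrightarrow> Q z"
    using assms unfolding generic_def by blast
  obtain w where "G w \<noteq> 0" "H w \<noteq> 0"
    using poly_fun_common_nonzero[OF G(1,2) H(1,2)] by blast
  then show ?thesis
    by (intro genericI[of "\<lambda>z. G z * H z" w]) (auto intro: poly_fun.intros G H)
qed

lemma generic_ball:
  fixes P :: "'i \<Rightarrow> ('v \<Rightarrow> 'a::field_char_0) \<Rightarrow> bool"
  assumes "finite A" "\<And>i. i \<in> A \<Longrightarrow> generic (P i)"
  shows "generic (\<lambda>z. \<forall>i\<in>A. P i z)"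
  using assms
proof (induction A rule: finite_induct)
  case empty
  show ?case by (rule genericI[of "\<lambda>_. 1"]) (auto intro: poly_fun.intros)
next
  case (insert x F)
  have "generic (\<lambda>z. P x z \<and> (\<forall>i\<in>F. P i z))"
    using insert by (intro generic_conj) auto
  then show ?case by simp
qed

section \<open>Linear systems depending polynomially on parameters\<close>

text \<open>\<open>R\<close> is the set of rows of a system in the unknowns \<open>c j\<close>. It
  is a set rather than a matrix because vanishing on a line, imposed for all parameters, gives
  infinitely many rows.\<close>

definition trivial_kernel :: "('j \<Rightarrow> 'a::field) set \<Rightarrow> 'j set \<Rightarrow> bool" where
  "trivial_kernel R J \<longleftrightarrow>
     (\<forall>c. (\<forall>r\<in>R. (\<Sum>j\<in>J. r j * c j) = 0) \<longrightarrow> (\<forall>j\<in>J. c j = 0))"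

lemma trivial_kernelD:
  "trivial_kernel R J \<Longrightarrow> (\<And>r. r \<in> R \<Longrightarrow> (\<Sum>j\<in>J. r j * c j) = 0) \<Longrightarrow> j \<in> J \<Longrightarrow> c j = 0"
  unfolding trivial_kernel_def by blast

lemma trivial_kernel_pivot:
  fixes R :: "('j \<Rightarrow> 'a::field) set"
  assumes "finite J" "m \<notin> J" and "trivial_kernel R (insert m J)"
  shows "\<exists>r\<in>R. r m \<noteq> 0"
proof (rule ccontr)
  assume "\<not> ?thesis"
  then have "(\<Sum>j\<in>insert m J. r j * (if j = m then 1 else 0)) = 0" if "r \<in> R" for r
    using that by (intro sum.neutral) auto
  from trivial_kernelD[OF assms(3) this, of m] show False by simp
qed

text \<open>One elimination step with pivot \<open>p m\<close>. Cross-multiplying instead of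
  dividing keeps the rows polynomial in the parameters.\<close>

lemma trivial_kernel_eliminate:
  fixes R :: "('j \<Rightarrow> 'a::field) set"
  assumes J: "finite J" "m \<notin> J" and p: "p m \<noteq> 0"
  shows "trivial_kernel ((\<lambda>r j. p m * r j - r m * p j) ` R) J \<longleftrightarrow>
         trivial_kernel (insert p R) (insert m J)"
proof
  assume L: "trivial_kernel ((\<lambda>r j. p m * r j - r m * p j) ` R) J"
  show "trivial_kernel (insert p R) (insert m J)"
    unfolding trivial_kernel_def
  proof (intro allI impI)
    fix c assume c: "\<forall>r\<in>insert p R. (\<Sum>j\<in>insert m J. r j * c j) = 0"
    have eq: "(\<Sum>j\<in>J. r j * c j) = - r m * c m" if "r \<in> insert p R" for r
      using c that J by (auto simp: eq_neg_iff_add_eq_0 add.commute)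
    have "(\<Sum>j\<in>J. (p m * r j - r m * p j) * c j) = 0" if "r \<in> R" for r
    proof -
      have "(\<Sum>j\<in>J. (p m * r j - r m * p j) * c j)
        = p m * (\<Sum>j\<in>J. r j * c j) - r m * (\<Sum>j\<in>J. p j * c j)"
        by (simp add: sum_subtractf sum_distrib_left algebra_simps)
      then show ?thesis using eq[of r] eq[of p] that by simp
    qed
    then have cJ: "c j = 0" if "j \<in> J" for j
      using trivial_kernelD[OF L _ that, of c] by auto
    then have "(\<Sum>j\<in>J. p j * c j) = 0" by simp
    with eq[of p] p have "c m = 0" by simp
    with cJ show "\<forall>j\<in>insert m J. c j = 0" by auto
  qed
next
  assume R: "trivial_kernel (insert p R) (insert m J)"
  show "trivial_kernel ((\<lambda>r j. p m * r j - r m * p j) ` R) J"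
    unfolding trivial_kernel_def
  proof (intro allI impI)
    fix c assume c: "\<forall>r\<in>(\<lambda>r j. p m * r j - r m * p j) ` R. (\<Sum>j\<in>J. r j * c j) = 0"
    define c' where "c' = c(m := - (\<Sum>j\<in>J. p j * c j) / p m)"
    have sum: "(\<Sum>j\<in>insert m J. r j * c' j) = r m * c' m + (\<Sum>j\<in>J. r j * c j)" for r
    proof -
      have "(\<Sum>j\<in>J. r j * c' j) = (\<Sum>j\<in>J. r j * c j)"
        using J by (intro sum.cong) (auto simp: c'_def)
      then show ?thesis using J by simp
    qed
    have "(\<Sum>j\<in>insert m J. r j * c' j) = 0" if "r \<in> insert p R" for r
    proof (cases "r = p")
      case True
      then show ?thesis unfolding sum using p by (simp add: c'_def)
    next
      case False
      then have "0 = (\<Sum>j\<in>J. (p m * r j - r m * p j) * c j)" using c that by auto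
      also have "\<dots> = p m * (\<Sum>j\<in>J. r j * c j) - r m * (\<Sum>j\<in>J. p j * c j)"
        by (simp add: sum_subtractf sum_distrib_left algebra_simps)
      finally show ?thesis unfolding sum using p by (simp add: c'_def field_simps)
    qed
    then have c': "c' j = 0" if "j \<in> insert m J" for j
      using trivial_kernelD[OF R _ that] by blast
    show "\<forall>j\<in>J. c j = 0"
    proof
      fix j assume "j \<in> J"
      with c'[of j] J(2) show "c j = 0" by (auto simp: c'_def split: if_splits)
    qed
  qed
qed

text \<open>Eliminate with pivots that are nonzero at \<open>w0\<close>; \<open>G\<close> is their
  product, and wherever it is nonzero the same elimination goes through. This replaces a maximal
  minor, which would have to be selected from possibly infinitely many rows.\<close>

lemma trivial_kernel_open:
  fixes R :: "(('v \<Rightarrow> 'a::field) \<Rightarrow> 'j \<Rightarrow> 'a) set"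
  assumes "finite J" and "\<And>r j. r \<in> R \<Longrightarrow> j \<in> J \<Longrightarrow> poly_fun (\<lambda>w. r w j)"
    and "trivial_kernel ((\<lambda>r. r w0) ` R) J"
  shows "\<exists>G. poly_fun G \<and> G w0 \<noteq> 0 \<and> (\<forall>w. G w \<noteq> 0 \<longrightarrow> trivial_kernel ((\<lambda>r. r w) ` R) J)"
  using assms
proof (induction J arbitrary: R rule: finite_induct)
  case empty
  show ?case
    by (rule exI[of _ "\<lambda>_. 1"]) (auto intro: poly_fun.intros simp: trivial_kernel_def)
next
  case (insert m J)
  obtain p where p: "p \<in> R" "p w0 m \<noteq> 0"
    using trivial_kernel_pivot[OF insert.hyps insert.prems(2)] by auto
  let ?e = "\<lambda>r w j. p w m * r w j - r w m * p w j"
  have elim: "trivial_kernel ((\<lambda>r. r w) ` ?e ` R) J \<longleftrightarrow> trivial_kernel ((\<lambda>r. r w) ` R) (insert m J)"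
    if "p w m \<noteq> 0" for w
  proof -
    have "(\<lambda>r. r w) ` ?e ` R = (\<lambda>r j. p w m * r j - r m * p w j) ` (\<lambda>r. r w) ` R"
      by (simp add: image_image)
    moreover have "insert (p w) ((\<lambda>r. r w) ` R) = (\<lambda>r. r w) ` R" using p(1) by auto
    ultimately show ?thesis
      using trivial_kernel_eliminate[where p = "p w" and R = "(\<lambda>r. r w) ` R", OF insert.hyps that]
      by simp
  qed
  have "\<exists>G. poly_fun G \<and> G w0 \<noteq> 0 \<and> (\<forall>w. G w \<noteq> 0 \<longrightarrow> trivial_kernel ((\<lambda>r. r w) ` ?e ` R) J)"
  proof (rule insert.IH)
    show "poly_fun (\<lambda>w. r w j)" if "r \<in> ?e ` R" "j \<in> J" for r j
      using that insert.prems(1) p(1) by (auto intro!: poly_fun_intros)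
    show "trivial_kernel ((\<lambda>r. r w0) ` ?e ` R) J"
      using elim p insert.prems(2) by blast
  qed
  then obtain G where G: "poly_fun G" "G w0 \<noteq> 0"
    "\<And>w. G w \<noteq> 0 \<Longrightarrow> trivial_kernel ((\<lambda>r. r w) ` ?e ` R) J" by blast
  show ?case
    using G p elim insert.prems(1)
    by (intro exI[of _ "\<lambda>w. G w * p w m"]) (auto intro!: poly_fun.intros)
qed

text \<open>The same elimination, now carrying a right-hand side along.\<close>

lemma trivial_kernel_surjective:
  fixes r :: "'i \<Rightarrow> 'j \<Rightarrow> 'a::field"
  assumes "finite J" "finite I" "card I = card J" "trivial_kernel (r ` I) J"
  shows "\<exists>c. \<forall>i\<in>I. (\<Sum>j\<in>J. r i j * c j) = b i"
  using assms
proof (induction J arbitrary: I r b rule: finite_induct)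
  case empty
  then show ?case by simp
next
  case (insert m J)
  obtain p where p: "p \<in> I" "r p m \<noteq> 0"
    using trivial_kernel_pivot[OF insert.hyps insert.prems(3)] by auto
  let ?I = "I - {p}"
  let ?e = "\<lambda>i j. r p m * r i j - r i m * r p j"
  have "insert (r p) (r ` ?I) = r ` I" using p(1) by auto
  then have "trivial_kernel ((\<lambda>q j. r p m * q j - q m * r p j) ` r ` ?I) J"
    using trivial_kernel_eliminate[where p = "r p" and R = "r ` ?I", OF insert.hyps p(2)]
      insert.prems(3) by simp
  then have "trivial_kernel (?e ` ?I) J" by (simp add: image_image)
  moreover have "card ?I = card J" using insert p by simp
  ultimately obtain c where c: "\<And>i. i \<in> ?I \<Longrightarrow>
      (\<Sum>j\<in>J. ?e i j * c j) = r p m * b i - r i m * b p"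
    using insert.IH[of ?I ?e "\<lambda>i. r p m * b i - r i m * b p"] insert.prems(1) by auto
  define c' where "c' = c(m := (b p - (\<Sum>j\<in>J. r p j * c j)) / r p m)"
  have sum: "(\<Sum>j\<in>insert m J. r i j * c' j) = r i m * c' m + (\<Sum>j\<in>J. r i j * c j)" for i
  proof -
    have "(\<Sum>j\<in>J. r i j * c' j) = (\<Sum>j\<in>J. r i j * c j)"
      using insert.hyps by (intro sum.cong) (auto simp: c'_def)
    then show ?thesis using insert.hyps by simp
  qed
  have "(\<Sum>j\<in>insert m J. r i j * c' j) = b i" if "i \<in> I" for i
  proof (cases "i = p")
    case True
    then show ?thesis unfolding sum using p by (simp add: c'_def)
  next
    case False
    then have "r p m * b i - r i m * b p = (\<Sum>j\<in>J. ?e i j * c j)" using c that by auto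
    also have "\<dots> = r p m * (\<Sum>j\<in>J. r i j * c j) - r i m * (\<Sum>j\<in>J. r p j * c j)"
      by (simp add: sum_subtractf sum_distrib_left algebra_simps)
    finally have "r i m * (b p - (\<Sum>j\<in>J. r p j * c j)) + r p m * (\<Sum>j\<in>J. r i j * c j) = r p m * b i"
      by (simp add: algebra_simps)
    then show ?thesis unfolding sum using p by (simp add: c'_def field_simps)
  qed
  then show ?case by blast
qed

section \<open>Forms and their monomials\<close>

lemma pderiv_sum: "pderiv (\<Sum>i\<in>A. f i) = (\<Sum>i\<in>A. pderiv (f i))"
  by (induction A rule: infinite_finite_induct) (simp_all add: pderiv_add)

text \<open>In characteristic zero differentiation lowers the order of a root by exactly one, so
  \<open>Z\<close> and \<open>D\<close> together form a submultiset of the roots.\<close>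

lemma poly_double_roots_bound:
  fixes p :: "'a::field_char_0 poly"
  assumes "finite Z" "D \<subseteq> Z" "\<And>z. z \<in> Z \<Longrightarrow> poly p z = 0"
    and "\<And>z. z \<in> D \<Longrightarrow> poly (pderiv p) z = 0"
    and "degree p < card Z + card D"
  shows "p = 0"
proof (rule ccontr)
  assume p: "p \<noteq> 0"
  have D: "finite D" using assms(1,2) finite_subset by blast
  have "mset_set Z + mset_set D \<subseteq># proots p"
  proof (rule mset_subset_eqI)
    fix z
    have "Suc 0 \<le> order z p" if "z \<in> Z"
      using assms(3)[OF that] p order_root[of p z] by simp
    moreover have "2 \<le> order z p" if "z \<in> D"
    proof -
      have z: "poly p z = 0" using that assms(2,3) by blast
      have "pderiv p \<noteq> 0"
      proof
        assume "pderiv p = 0"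
        then obtain h where "p = [:h:]" using pderiv_iszero by blast
        with z p show False by simp
      qed
      then show ?thesis
        using order_pderiv[OF p z] assms(4)[OF that] order_root[of "pderiv p" z] by simp
    qed
    ultimately show "count (mset_set Z + mset_set D) z \<le> count (proots p) z"
      using p assms(1,2) D by (auto simp: count_mset_set')
  qed
  then have "size (mset_set Z + mset_set D) \<le> size (proots p)" by (rule size_mset_mono)
  then show False using size_proots_le[of p] assms(5) by simp
qed

lemma power_sum_eq_zero:
  fixes e :: "nat \<Rightarrow> 'a::field_char_0"
  assumes "finite Z" "D \<subseteq> Z" and Z: "\<And>z. z \<in> Z \<Longrightarrow> (\<Sum>i\<le>d. e i * z ^ i) = 0"
    and D: "\<And>z. z \<in> D \<Longrightarrow> (\<Sum>i\<le>d. e i * (of_nat i * z ^ (i - 1))) = 0"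
    and "d < card Z + card D" and "i \<le> d"
  shows "e i = 0"
proof -
  define p where "p = (\<Sum>i\<le>d. monom (e i) i)"
  have p: "poly p z = (\<Sum>i\<le>d. e i * z ^ i)" for z
    by (simp add: p_def poly_sum poly_monom)
  have "pderiv p = (\<Sum>i\<le>d. monom (of_nat i * e i) (i - 1))"
    by (simp add: p_def pderiv_sum pderiv_monom)
  then have p': "poly (pderiv p) z = (\<Sum>i\<le>d. e i * (of_nat i * z ^ (i - 1)))" for z
    by (simp add: poly_sum poly_monom algebra_simps)
  have "degree p \<le> d"
    unfolding p_def by (intro degree_sum_le) (auto intro: order_trans[OF degree_monom_le])
  then have "p = 0"
    using assms by (intro poly_double_roots_bound[OF assms(1,2)]) (auto simp: p p')
  then have "coeff p i = 0" by simp
  moreover have "coeff p i = (\<Sum>j\<le>d. if j = i then e j else 0)"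
    by (simp add: p_def coeff_sum)
  ultimately show ?thesis using assms(6) by simp
qed

text \<open>The exponent map \<open>e\<close> is arbitrary so that it can encode whole exponent
  vectors.\<close>

lemma power_sum_identity:
  fixes c :: "'i \<Rightarrow> 'a::field_char_0"
  assumes "finite S" "inj_on e S" "\<And>t. (\<Sum>i\<in>S. c i * t ^ e i) = 0" "k \<in> S"
  shows "c k = 0"
proof -
  define p where "p = (\<Sum>i\<in>S. monom (c i) (e i))"
  have "poly p t = 0" for t
    using assms(3)[of t] by (simp add: p_def poly_sum poly_monom)
  then have "p = 0" using poly_all_0_iff_0 by blast
  then have "0 = coeff p (e k)" by simp
  also have "\<dots> = (\<Sum>i\<in>S. if i = k then c i else 0)"
    unfolding p_def coeff_sum coeff_monom
    by (rule sum.cong) (use assms(2,4) in \<open>auto simp: inj_on_def\<close>)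
  also have "\<dots> = c k" using assms(1,4) by simp
  finally show ?thesis by simp
qed

definition mon :: "(nat \<Rightarrow> 'a::field) \<Rightarrow> (nat \<Rightarrow> nat) \<Rightarrow> 'a" where
  "mon x \<alpha> = (\<Prod>i<4. x i ^ \<alpha> i)"

lemma evalF_mon: "evalF d c x = (\<Sum>\<alpha>\<in>mons d. c \<alpha> * mon x \<alpha>)"
  by (simp add: evalF_def mon_def)

lemma lessThan_4: "{..<4::nat} = {0, 1, 2, 3}" by auto

lemma atLeast0LessThan_4: "{0..<4::nat} = {0, 1, 2, 3}" by auto

lemma mon_eq: "mon x \<alpha> = x 0 ^ \<alpha> 0 * x 1 ^ \<alpha> 1 * x 2 ^ \<alpha> 2 * x 3 ^ \<alpha> 3"
  by (simp add: mon_def lessThan_4 mult.assoc)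

lemma mons_iff: "\<alpha> \<in> mons d \<longleftrightarrow> (\<forall>i\<ge>4. \<alpha> i = 0) \<and> \<alpha> 0 + \<alpha> 1 + \<alpha> 2 + \<alpha> 3 = d"
  by (simp add: mons_def atLeast0LessThan_4 add.assoc)

lemma mons_ext: "\<alpha> \<in> mons d \<Longrightarrow> \<beta> \<in> mons d' \<Longrightarrow> (\<And>i. i < 4 \<Longrightarrow> \<alpha> i = \<beta> i) \<Longrightarrow> \<alpha> = \<beta>"
  by (rule ext) (metis mons_iff not_le)

lemma card_mons: "card (mons d) = (d + 3) choose 3" and finite_mons: "finite (mons d)"
proof -
  let ?L = "{l::nat list. size l = 4 \<and> sum_list l = d}"
  have card: "card ?L = (d + 3) choose 3"
  proof -
    have "(d + 4 - 1) choose d = (d + 3) choose d" by (rule arg_cong[of _ _ "\<lambda>n. n choose d"]) simp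
    also have "\<dots> = (d + 3) choose (d + 3 - d)" by (rule binomial_symmetric) simp
    finally show ?thesis unfolding card_length_sum_list by simp
  qed
  have "bij_betw (\<lambda>\<alpha>. map \<alpha> [0..<4]) (mons d) ?L"
  proof (rule bij_betw_imageI)
    show "inj_on (\<lambda>\<alpha>. map \<alpha> [0..<4]) (mons d)"
      by (rule inj_onI) (erule (1) mons_ext, simp)
    show "(\<lambda>\<alpha>. map \<alpha> [0..<4]) ` mons d = ?L"
    proof (intro equalityI subsetI)
      fix l assume "l \<in> (\<lambda>\<alpha>. map \<alpha> [0..<4]) ` mons d"
      then show "l \<in> ?L" by (auto simp: mons_def interv_sum_list_conv_sum_set_nat)
    next
      fix l assume l: "l \<in> ?L"
      define \<alpha> where "\<alpha> i = (if i < 4 then l ! i else 0)" for i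
      have "map \<alpha> [0..<4] = l" using l by (intro nth_equalityI) (auto simp: \<alpha>_def)
      moreover have "sum \<alpha> {0..<4} = d"
        using l calculation interv_sum_list_conv_sum_set_nat[of \<alpha> 0 4] by simp
      then have "\<alpha> \<in> mons d" by (simp add: mons_def \<alpha>_def)
      ultimately show "l \<in> (\<lambda>\<alpha>. map \<alpha> [0..<4]) ` mons d" by blast
    qed
  qed
  \<comment> \<open>A nonzero cardinality also yields finiteness, since infinite sets have
    \<open>card\<close> 0.\<close>
  moreover have "card ?L \<noteq> 0" unfolding card by simp
  ultimately have "card (mons d) = (d + 3) choose 3" "card (mons d) \<noteq> 0"
    using card by (auto dest: bij_betw_same_card)
  then show "card (mons d) = (d + 3) choose 3" "finite (mons d)"
    using card.infinite[of "mons d"] by auto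
qed

lemma forms_sum:
  "(\<And>i. i \<in> A \<Longrightarrow> g i \<in> forms d) \<Longrightarrow> (\<lambda>\<alpha>. \<Sum>i\<in>A. k i * g i \<alpha>) \<in> forms d"
  by (auto simp: forms_def intro!: sum.neutral)

lemma forms_diff: "c \<in> forms d \<Longrightarrow> c' \<in> forms d \<Longrightarrow> (\<lambda>\<alpha>. c \<alpha> - c' \<alpha>) \<in> forms d"
  by (auto simp: forms_def)

lemma forms_eq_zeroI: "c \<in> forms d \<Longrightarrow> (\<And>\<alpha>. \<alpha> \<in> mons d \<Longrightarrow> c \<alpha> = 0) \<Longrightarrow> c = (\<lambda>_. 0)"
  by (auto simp: forms_def fun_eq_iff)

lemma evalF_sum: "evalF d (\<lambda>\<alpha>. \<Sum>i\<in>A. k i * g i \<alpha>) x = (\<Sum>i\<in>A. k i * evalF d (g i) x)"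
  by (subst (2) sum.cong[OF refl, of _ _ "\<lambda>i. \<Sum>\<alpha>\<in>mons d. k i * g i \<alpha> * mon x \<alpha>"])
    (simp_all add: evalF_mon sum_distrib_left sum_distrib_right mult.assoc sum.swap[of _ A])

lemma evalF_diff: "evalF d (\<lambda>\<alpha>. c \<alpha> - c' \<alpha>) x = evalF d c x - evalF d c' x"
  by (simp add: evalF_mon sum_subtractf left_diff_distrib)

lemma poly_fun_mon: "(\<And>m. poly_fun (\<lambda>z. X z m)) \<Longrightarrow> poly_fun (\<lambda>z. mon (X z) \<alpha>)"
  unfolding mon_def by (intro poly_fun_intros)

lemma poly_fun_evalF: "(\<And>m. poly_fun (\<lambda>z. X z m)) \<Longrightarrow> poly_fun (\<lambda>z. evalF d c (X z))"
  unfolding evalF_mon by (intro poly_fun_intros poly_fun_mon)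

lemma base_digits_unique:
  fixes a b :: nat
  assumes "a < n" "b < n" "a + n * x = b + n * y"
  shows "a = b" "x = y"
proof -
  have "a = (a + n * x) mod n" using assms(1) by simp
  also have "\<dots> = b" using assms(2,3) by simp
  finally show "a = b" .
  then show "x = y" using assms by simp
qed

text \<open>Kronecker substitution: the powers of \<open>t\<close> with exponents 1, n, n^2, n^3
  separate the monomials when n exceeds the degree.\<close>
lemma forms_zero_function:
  fixes c :: "(nat \<Rightarrow> nat) \<Rightarrow> 'a::field_char_0"
  assumes c: "c \<in> forms d" and 0: "\<And>x. evalF d c x = 0"
  shows "c = (\<lambda>_. 0)"
proof (rule forms_eq_zeroI[OF c])
  fix \<alpha> assume \<alpha>: "\<alpha> \<in> mons d"
  let ?n = "Suc d"
  let ?e = "\<lambda>\<alpha>. \<alpha> 0 + ?n * (\<alpha> 1 + ?n * (\<alpha> 2 + ?n * \<alpha> (3::nat)))"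
  show "c \<alpha> = 0"
  proof (rule power_sum_identity[where c = c and e = ?e, OF finite_mons])
    show "inj_on ?e (mons d)"
    proof (rule inj_onI)
      fix \<beta> \<gamma> assume m: "\<beta> \<in> mons d" "\<gamma> \<in> mons d" and e: "?e \<beta> = ?e \<gamma>"
      have lt: "\<beta> 0 < ?n" "\<beta> 1 < ?n" "\<beta> 2 < ?n" "\<gamma> 0 < ?n" "\<gamma> 1 < ?n" "\<gamma> 2 < ?n"
        using m unfolding mons_iff by linarith+
      note e0 = base_digits_unique[OF lt(1,4) e]
      note e1 = base_digits_unique[OF lt(2,5) e0(2)]
      note e2 = base_digits_unique[OF lt(3,6) e1(2)]
      show "\<beta> = \<gamma>"
      proof (rule mons_ext[OF m])
        fix i :: nat assume "i < 4"
        then have "i = 0 \<or> i = 1 \<or> i = 2 \<or> i = 3" by linarith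
        then show "\<beta> i = \<gamma> i" using e0(1) e1(1) e2 by auto
      qed
    qed
    fix t :: 'a
    have "evalF d c (\<lambda>i. t ^ (?n ^ i)) = (\<Sum>\<alpha>\<in>mons d. c \<alpha> * t ^ ?e \<alpha>)"
      unfolding evalF_mon mon_eq
      by (intro sum.cong refl)
        (simp add: power_add power_mult[symmetric] power2_eq_square power3_eq_cube algebra_simps)
    then show "(\<Sum>\<alpha>\<in>mons d. c \<alpha> * t ^ ?e \<alpha>) = 0" using 0 by simp
  qed (rule \<alpha>)
qed

section \<open>Restriction to a quadric\<close>

text \<open>An affine chart of the Segre embedding; the curves of constant first (or second) coordinate are
  the lines of the two rulings of the quadric.\<close>

definition seg :: "'a::field \<times> 'a \<Rightarrow> nat \<Rightarrow> 'a" where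
  "seg P m = (if m = 0 then 1 else if m = 1 then snd P else if m = 2 then fst P else fst P * snd P)"

definition quadric :: "(nat \<Rightarrow> 'a::field) \<Rightarrow> 'a" where
  "quadric x = x 0 * x 3 - x 1 * x 2"

text \<open>A form of bidegree (d, d) on the quadric, written in the chart of \<open>seg\<close>;
  \<open>e\<close> is its coefficient array.\<close>

definition biform :: "nat \<Rightarrow> (nat \<Rightarrow> nat \<Rightarrow> 'a::field) \<Rightarrow> 'a \<times> 'a \<Rightarrow> 'a" where
  "biform d e P = (\<Sum>i\<le>d. \<Sum>j\<le>d. e i j * (fst P ^ i * snd P ^ j))"

text \<open>A formal partial derivative; the truncated \<open>i - 1\<close> at \<open>i = 0\<close>
  is harmless because of the factor \<open>of_nat i\<close>.\<close>

definition biform_da :: "nat \<Rightarrow> (nat \<Rightarrow> nat \<Rightarrow> 'a::field) \<Rightarrow> 'a \<times> 'a \<Rightarrow> 'a" where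
  "biform_da d e P = (\<Sum>i\<le>d. \<Sum>j\<le>d. e i j * (of_nat i * fst P ^ (i - 1) * snd P ^ j))"

definition biform_db :: "nat \<Rightarrow> (nat \<Rightarrow> nat \<Rightarrow> 'a::field) \<Rightarrow> 'a \<times> 'a \<Rightarrow> 'a" where
  "biform_db d e P = (\<Sum>i\<le>d. \<Sum>j\<le>d. e i j * (fst P ^ i * (of_nat j * snd P ^ (j - 1))))"

text \<open>The coefficients of the restriction along \<open>seg\<close>. Monomials of degree
  \<open>d\<close> with the same index pair are those congruent modulo the quadric.\<close>

definition quadric_trace :: "nat \<Rightarrow> ((nat \<Rightarrow> nat) \<Rightarrow> 'a::field) \<Rightarrow> nat \<Rightarrow> nat \<Rightarrow> 'a" where
  "quadric_trace d c i j = (\<Sum>\<alpha> | \<alpha> \<in> mons d \<and> \<alpha> 2 + \<alpha> 3 = i \<and> \<alpha> 1 + \<alpha> 3 = j. c \<alpha>)"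

text \<open>\<open>h\<close> is arbitrary because this regrouping serves for values, for derivatives
  and for normal forms modulo the quadric.\<close>

lemma sum_quadric_trace:
  "(\<Sum>\<alpha>\<in>mons d. c \<alpha> * h (\<alpha> 2 + \<alpha> 3) (\<alpha> 1 + \<alpha> 3)) =
   (\<Sum>i\<le>d. \<Sum>j\<le>d. quadric_trace d c i j * h i j)"
proof -
  let ?g = "\<lambda>\<alpha>. (\<alpha> 2 + \<alpha> (3::nat), \<alpha> 1 + \<alpha> 3)"
  let ?h = "\<lambda>\<alpha>. c \<alpha> * h (\<alpha> 2 + \<alpha> 3) (\<alpha> 1 + \<alpha> 3)"
  have sub: "?g ` mons d \<subseteq> {..d} \<times> {..d}" by (auto simp: mons_iff)
  have "(\<Sum>i\<le>d. \<Sum>j\<le>d. quadric_trace d c i j * h i j)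
    = (\<Sum>y\<in>{..d} \<times> {..d}. quadric_trace d c (fst y) (snd y) * h (fst y) (snd y))"
    by (simp add: sum.cartesian_product split_def)
  also have "\<dots> = (\<Sum>y\<in>{..d} \<times> {..d}. \<Sum>\<alpha> | \<alpha> \<in> mons d \<and> ?g \<alpha> = y. ?h \<alpha>)"
    unfolding quadric_trace_def sum_distrib_right by (intro sum.cong) (auto intro!: sum.cong)
  also have "\<dots> = (\<Sum>\<alpha>\<in>mons d. ?h \<alpha>)"
    using sum.group[OF finite_mons _ sub, of ?h] by simp
  finally show ?thesis ..
qed

lemma mon_seg: "mon (seg P) \<alpha> = fst P ^ (\<alpha> 2 + \<alpha> 3) * snd P ^ (\<alpha> 1 + \<alpha> 3)"
  by (simp add: mon_eq seg_def power_add power_mult_distrib algebra_simps)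

lemma evalF_seg: "evalF d c (seg P) = biform d (quadric_trace d c) P"
  unfolding evalF_mon mon_seg biform_def
  using sum_quadric_trace[of c "\<lambda>i j. fst P ^ i * snd P ^ j" d] by simp

text \<open>Trading \<open>x 0 * x 3\<close> for \<open>x 1 * x 2\<close> until one of
  \<open>x 0\<close>, \<open>x 3\<close> is gone leads to a normal form that depends only on
  \<open>i\<close> and \<open>j\<close>; each trade costs a multiple of the quadric. The clause for
  \<open>d < 2\<close> guards against the truncation of \<open>d - 2\<close>.\<close>

lemma monomial_mod_quadric:
  fixes d n0 n1 n2 n3 :: nat
  assumes "n0 + n1 + n2 + n3 = d"
  defines "i \<equiv> n2 + n3" and "j \<equiv> n1 + n3"
  shows "\<exists>g\<in>forms (d - 2). (d < 2 \<longrightarrow> g = (\<lambda>_. 0::'a::field)) \<and>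
    (\<forall>x. x 0 ^ n0 * x 1 ^ n1 * x 2 ^ n2 * x 3 ^ n3 =
         x 0 ^ (d - (i + j)) * x 1 ^ min j (d - i) * x 2 ^ min i (d - j) * x 3 ^ (i + j - d)
         + quadric x * evalF (d - 2) g x)"
  using assms(1) unfolding i_def j_def
proof (induction n0 arbitrary: n1 n2 n3)
  case 0
  then have "d - (n2 + n3 + (n1 + n3)) = 0" "min (n1 + n3) (d - (n2 + n3)) = n1"
    "min (n2 + n3) (d - (n1 + n3)) = n2" "n2 + n3 + (n1 + n3) - d = n3" by auto
  then show ?case by (intro bexI[of _ "\<lambda>_. 0"]) (simp_all add: evalF_def forms_def)
next
  case (Suc n)
  show ?case
  proof (cases n3)
    case 0
    then have "d - (n2 + n3 + (n1 + n3)) = Suc n" "min (n1 + n3) (d - (n2 + n3)) = n1"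
      "min (n2 + n3) (d - (n1 + n3)) = n2" "n2 + n3 + (n1 + n3) - d = n3" using Suc.prems by auto
    then show ?thesis by (intro bexI[of _ "\<lambda>_. 0"]) (simp_all add: evalF_def forms_def)
  next
    case (Suc m)
    let ?\<alpha> = "\<lambda>k. if k = 0 then n else if k = 1 then n1 else if k = 2 then n2 else if k = 3 then m else (0::nat)"
    have \<alpha>: "?\<alpha> \<in> mons (d - 2)" using Suc Suc.prems by (simp add: mons_iff)
    have "n + Suc n1 + Suc n2 + m = d" using Suc Suc.prems by simp
    from Suc.IH[OF this] have "\<exists>g\<in>forms (d - 2). \<forall>x::nat \<Rightarrow> 'a. x 0 ^ n * x 1 ^ Suc n1 * x 2 ^ Suc n2 * x 3 ^ m =
         x 0 ^ (d - (n2 + n3 + (n1 + n3))) * x 1 ^ min (n1 + n3) (d - (n2 + n3)) *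
         x 2 ^ min (n2 + n3) (d - (n1 + n3)) * x 3 ^ (n2 + n3 + (n1 + n3) - d)
         + quadric x * evalF (d - 2) g x"
      unfolding Suc add_Suc_right add_Suc by blast
    then obtain g where g: "g \<in> forms (d - 2)"
      "\<And>x::nat \<Rightarrow> 'a. x 0 ^ n * x 1 ^ Suc n1 * x 2 ^ Suc n2 * x 3 ^ m =
         x 0 ^ (d - (n2 + n3 + (n1 + n3))) * x 1 ^ min (n1 + n3) (d - (n2 + n3)) *
         x 2 ^ min (n2 + n3) (d - (n1 + n3)) * x 3 ^ (n2 + n3 + (n1 + n3) - d)
         + quadric x * evalF (d - 2) g x"
      by blast
    define g' where "g' \<alpha> = g \<alpha> + (if \<alpha> = ?\<alpha> then 1 else 0)" for \<alpha>
    have g': "g' \<in> forms (d - 2)" using g(1) \<alpha> by (auto simp: forms_def g'_def)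
    have "evalF (d - 2) g' x = evalF (d - 2) g x + (\<Sum>\<beta>\<in>mons (d - 2). if \<beta> = ?\<alpha> then mon x \<beta> else 0)" for x
      unfolding evalF_mon sum.distrib[symmetric] by (rule sum.cong) (simp_all add: g'_def algebra_simps)
    then have ev: "evalF (d - 2) g' x = evalF (d - 2) g x + mon x ?\<alpha>" for x
      using \<alpha> by (simp add: finite_mons)
    have "mon x ?\<alpha> = x 0 ^ n * x 1 ^ n1 * x 2 ^ n2 * x 3 ^ m" for x :: "nat \<Rightarrow> 'a"
      by (simp add: mon_eq)
    then have "x 0 ^ Suc n * x 1 ^ n1 * x 2 ^ n2 * x 3 ^ n3 =
        x 0 ^ n * x 1 ^ Suc n1 * x 2 ^ Suc n2 * x 3 ^ m + quadric x * mon x ?\<alpha>" for x :: "nat \<Rightarrow> 'a"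
      by (simp add: quadric_def Suc algebra_simps)
    then have "x 0 ^ Suc n * x 1 ^ n1 * x 2 ^ n2 * x 3 ^ n3 =
         x 0 ^ (d - (n2 + n3 + (n1 + n3))) * x 1 ^ min (n1 + n3) (d - (n2 + n3)) *
         x 2 ^ min (n2 + n3) (d - (n1 + n3)) * x 3 ^ (n2 + n3 + (n1 + n3) - d)
         + quadric x * evalF (d - 2) g' x" for x :: "nat \<Rightarrow> 'a"
      unfolding g(2) ev by (simp add: algebra_simps)
    moreover have "\<not> d < 2" using Suc Suc.prems by simp
    ultimately show ?thesis using g' by blast
  qed
qed

text \<open>The trace collects the terms with a common normal form, so if it is zero only the
  multiples of the quadric survive.\<close>

lemma quadric_divides:
  fixes c :: "(nat \<Rightarrow> nat) \<Rightarrow> 'a::field"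
  assumes "\<And>i j. i \<le> d \<Longrightarrow> j \<le> d \<Longrightarrow> quadric_trace d c i j = 0"
  shows "\<exists>g\<in>forms (d - 2). (d < 2 \<longrightarrow> g = (\<lambda>_. 0)) \<and>
           (\<forall>x. evalF d c x = quadric x * evalF (d - 2) g x)"
proof -
  define N where "N x i j = x 0 ^ (d - (i + j)) * x 1 ^ min j (d - i) * x 2 ^ min i (d - j) * x 3 ^ (i + j - d)"
    for x :: "nat \<Rightarrow> 'a" and i j
  have "\<exists>g. \<alpha> \<in> mons d \<longrightarrow> g \<in> forms (d - 2) \<and> (d < 2 \<longrightarrow> g = (\<lambda>_. 0)) \<and>
    (\<forall>x. mon x \<alpha> = N x (\<alpha> 2 + \<alpha> 3) (\<alpha> 1 + \<alpha> 3) + quadric x * evalF (d - 2) g x)" for \<alpha>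
    using monomial_mod_quadric[of "\<alpha> 0" "\<alpha> 1" "\<alpha> 2" "\<alpha> 3" d, where 'a = 'a]
    unfolding mons_iff mon_eq N_def by blast
  then obtain g where g: "\<And>\<alpha>. \<alpha> \<in> mons d \<Longrightarrow> g \<alpha> \<in> forms (d - 2)"
    "\<And>\<alpha>. \<alpha> \<in> mons d \<Longrightarrow> d < 2 \<Longrightarrow> g \<alpha> = (\<lambda>_. 0)"
    "\<And>\<alpha> x. \<alpha> \<in> mons d \<Longrightarrow>
      mon x \<alpha> = N x (\<alpha> 2 + \<alpha> 3) (\<alpha> 1 + \<alpha> 3) + quadric x * evalF (d - 2) (g \<alpha>) x"
    by metis
  let ?g = "\<lambda>\<beta>. \<Sum>\<alpha>\<in>mons d. c \<alpha> * g \<alpha> \<beta>"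
  have "evalF d c x = quadric x * evalF (d - 2) ?g x" for x
  proof -
    have "evalF d c x = (\<Sum>\<alpha>\<in>mons d. c \<alpha> * N x (\<alpha> 2 + \<alpha> 3) (\<alpha> 1 + \<alpha> 3))
      + (\<Sum>\<alpha>\<in>mons d. quadric x * (c \<alpha> * evalF (d - 2) (g \<alpha>) x))"
      unfolding evalF_mon[of d] sum.distrib[symmetric]
      by (rule sum.cong) (simp_all add: g(3) algebra_simps)
    also have "(\<Sum>\<alpha>\<in>mons d. c \<alpha> * N x (\<alpha> 2 + \<alpha> 3) (\<alpha> 1 + \<alpha> 3)) = 0"
      unfolding sum_quadric_trace using assms by simp
    finally show ?thesis by (simp add: evalF_sum sum_distrib_left)
  qed
  moreover have "?g \<in> forms (d - 2)" using g(1) by (rule forms_sum)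
  moreover have "?g = (\<lambda>_. 0)" if "d < 2" using g(2) that by auto
  ultimately show ?thesis by blast
qed

section \<open>Chords of the quadric\<close>

definition line_through :: "'a::field \<times> 'a \<Rightarrow> 'a \<times> 'a \<Rightarrow> 'a \<Rightarrow> 'a \<Rightarrow> nat \<Rightarrow> 'a" where
  "line_through P P' s t = (\<lambda>m. s * seg P m + t * seg P' m)"

definition vanishes_on_line :: "nat \<Rightarrow> ((nat \<Rightarrow> nat) \<Rightarrow> 'a::field) \<Rightarrow> 'a \<times> 'a \<Rightarrow> 'a \<times> 'a \<Rightarrow> bool" where
  "vanishes_on_line d c P P' \<longleftrightarrow> (\<forall>s t. evalF d c (line_through P P' s t) = 0)"

lemma vanishes_on_lineD:
  assumes "vanishes_on_line d c P P'"
  shows "evalF d c (seg P) = 0" "evalF d c (seg P') = 0"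
proof -
  have "line_through P P' 1 0 = seg P" "line_through P P' 0 1 = seg P'"
    by (simp_all add: line_through_def)
  then show "evalF d c (seg P) = 0" "evalF d c (seg P') = 0"
    using assms unfolding vanishes_on_line_def by metis+
qed

lemma vanishes_on_ruling:
  assumes "vanishes_on_line d c (a, b) (a, b')" "b \<noteq> b'"
  shows "evalF d c (seg (a, b'')) = 0"
proof -
  define t where "t = (b'' - b) / (b' - b)"
  have t: "b'' = b + t * (b' - b)" using assms(2) by (simp add: t_def)
  have "line_through (a, b) (a, b') (1 - t) t = seg (a, b'')"
    by (rule ext) (simp add: line_through_def seg_def t algebra_simps)
  then show ?thesis using assms(1) unfolding vanishes_on_line_def by metis
qed

text \<open>A chord whose ends differ in both coordinates meets the quadric only in its
  ends.\<close>

lemma quadric_line_through: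
  "quadric (line_through P P' s t) = s * t * ((fst P - fst P') * (snd P - snd P'))"
  by (simp add: quadric_def line_through_def seg_def algebra_simps)

text \<open>Along the chord the product of the quadric and \<open>g\<close> vanishes as a polynomial
  function of the two parameters, and the quadric does not; \<open>poly_fun_common_nonzero\<close>
  supplies the absence of zero divisors.\<close>

lemma vanishes_on_line_quotient:
  fixes c g :: "(nat \<Rightarrow> nat) \<Rightarrow> 'a::field_char_0"
  assumes cg: "\<And>x. evalF d c x = quadric x * evalF d' g x"
    and "vanishes_on_line d c P P'" "fst P \<noteq> fst P'" "snd P \<noteq> snd P'"
  shows "vanishes_on_line d' g P P'"
proof (rule ccontr)
  assume "\<not> ?thesis"
  then obtain s t where st: "evalF d' g (line_through P P' s t) \<noteq> 0"
    unfolding vanishes_on_line_def by blast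
  \<comment> \<open>The two line parameters are treated as variables indexed by
    \<open>bool\<close>.\<close>
  let ?G = "\<lambda>z. evalF d' g (line_through P P' (z True) (z False))"
  let ?H = "\<lambda>z. z True * z False :: 'a"
  have G: "poly_fun ?G" unfolding line_through_def by (intro poly_fun_evalF poly_fun_intros)
  have H: "poly_fun ?H" by (intro poly_fun_intros)
  have "?G (\<lambda>b. if b then s else t) \<noteq> 0" "?H (\<lambda>_. 1) \<noteq> 0" using st by simp_all
  from poly_fun_common_nonzero[OF G this(1) H this(2)]
  obtain z where "?G z \<noteq> 0" "z True * z False \<noteq> 0" by blast
  moreover have "quadric (line_through P P' (z True) (z False)) * ?G z = 0"
    using assms(2) unfolding vanishes_on_line_def cg by blast
  ultimately show False using assms(3,4) by (simp add: quadric_line_through)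
qed

text \<open>A configuration is a graph on the natural numbers: \<open>w (n, False)\<close> and \<open>w (n, True)\<close> are the
  coordinates of the vertex \<open>n\<close> on the quadric, and every edge stands for the line joining its ends.\<close>

definition pt :: "(nat \<times> bool \<Rightarrow> 'a) \<Rightarrow> nat \<Rightarrow> 'a \<times> 'a" where
  "pt w n = (w (n, False), w (n, True))"

definition good :: "nat \<Rightarrow> (nat \<times> nat) set \<Rightarrow> (nat \<times> bool \<Rightarrow> 'a::field) \<Rightarrow> bool" where
  "good d E w \<longleftrightarrow>
     (\<forall>c\<in>forms d. (\<forall>(m, n)\<in>E. vanishes_on_line d c (pt w m) (pt w n)) \<longrightarrow> c = (\<lambda>_. 0))"

lemma poly_fun_seg:
  assumes "\<And>c. poly_fun (\<lambda>z. W z (n, c))"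
  shows "poly_fun (\<lambda>z. seg (pt (W z) n) m)"
  by (cases "m = 0"; cases "m = 1"; cases "m = 2")
    (auto simp: seg_def pt_def intro: poly_fun.intros assms)

text \<open>Mediates between forms, which are zero off \<open>mons d\<close>, and
  \<open>trivial_kernel\<close>, which ignores values there.\<close>

lemma forms_kernel_open:
  fixes R :: "(('v \<Rightarrow> 'a::field) \<Rightarrow> (nat \<Rightarrow> nat) \<Rightarrow> 'a) set"
  assumes poly: "\<And>r \<alpha>. r \<in> R \<Longrightarrow> poly_fun (\<lambda>w. r w \<alpha>)"
    and w0: "\<And>c. c \<in> forms d \<Longrightarrow> (\<And>r. r \<in> R \<Longrightarrow> (\<Sum>\<alpha>\<in>mons d. c \<alpha> * r w0 \<alpha>) = 0) \<Longrightarrow> c = (\<lambda>_. 0)"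
  shows "\<exists>G. poly_fun G \<and> G w0 \<noteq> 0 \<and> (\<forall>w. G w \<noteq> 0 \<longrightarrow>
    (\<forall>c\<in>forms d. (\<forall>r\<in>R. (\<Sum>\<alpha>\<in>mons d. c \<alpha> * r w \<alpha>) = 0) \<longrightarrow> c = (\<lambda>_. 0)))"
proof -
  have "\<exists>G. poly_fun G \<and> G w0 \<noteq> 0 \<and> (\<forall>w. G w \<noteq> 0 \<longrightarrow> trivial_kernel ((\<lambda>r. r w) ` R) (mons d))"
  proof (rule trivial_kernel_open[OF finite_mons])
    show "poly_fun (\<lambda>w. r w j)" if "r \<in> R" for r j using that by (rule poly)
    show "trivial_kernel ((\<lambda>r. r w0) ` R) (mons d)"
      unfolding trivial_kernel_def
    proof (intro allI impI)
      fix c assume c: "\<forall>r\<in>(\<lambda>r. r w0) ` R. (\<Sum>j\<in>mons d. r j * c j) = 0"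
      let ?c = "\<lambda>\<alpha>. if \<alpha> \<in> mons d then c \<alpha> else 0"
      have "?c = (\<lambda>_. 0)"
      proof (rule w0)
        fix r assume "r \<in> R"
        have "(\<Sum>\<alpha>\<in>mons d. ?c \<alpha> * r w0 \<alpha>) = (\<Sum>\<alpha>\<in>mons d. r w0 \<alpha> * c \<alpha>)"
          by (rule sum.cong) simp_all
        then show "(\<Sum>\<alpha>\<in>mons d. ?c \<alpha> * r w0 \<alpha>) = 0" using bspec[OF c imageI[OF \<open>r \<in> R\<close>]] by simp
      qed (simp add: forms_def)
      then show "\<forall>j\<in>mons d. c j = 0" by (auto simp: fun_eq_iff split: if_splits)
    qed
  qed
  then obtain G where G: "poly_fun G" "G w0 \<noteq> 0"
    "\<forall>w. G w \<noteq> 0 \<longrightarrow> trivial_kernel ((\<lambda>r. r w) ` R) (mons d)" by blast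
  have "c = (\<lambda>_. 0)" if w: "G w \<noteq> 0" and c: "c \<in> forms d"
    "\<forall>r\<in>R. (\<Sum>\<alpha>\<in>mons d. c \<alpha> * r w \<alpha>) = 0" for w c
  proof (rule forms_eq_zeroI[OF c(1)])
    fix \<alpha> assume \<alpha>: "\<alpha> \<in> mons d"
    show "c \<alpha> = 0"
      by (rule trivial_kernelD[where c = c, OF G(3)[rule_format, OF w] _ \<alpha>])
        (use c(2) in \<open>auto simp: mult.commute\<close>)
  qed
  then show ?thesis using G(1,2) by blast
qed

lemma good_generic:
  fixes w0 :: "nat \<times> bool \<Rightarrow> 'a::field"
  assumes "good d E w0"
  shows "generic (\<lambda>w :: nat \<times> bool \<Rightarrow> 'a. good d E w)"
proof -
  define R :: "((nat \<times> bool \<Rightarrow> 'a) \<Rightarrow> (nat \<Rightarrow> nat) \<Rightarrow> 'a) set" where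
    "R = (\<lambda>((m, n), s, t) w. mon (line_through (pt w m) (pt w n) s t)) ` (E \<times> UNIV)"
  have eq: "good d E w \<longleftrightarrow>
      (\<forall>c\<in>forms d. (\<forall>r\<in>R. (\<Sum>\<alpha>\<in>mons d. c \<alpha> * r w \<alpha>) = 0) \<longrightarrow> c = (\<lambda>_. 0))" for w
    by (simp add: R_def good_def vanishes_on_line_def evalF_mon split_def)
  have "\<exists>G. poly_fun G \<and> G w0 \<noteq> 0 \<and> (\<forall>w. G w \<noteq> 0 \<longrightarrow>
    (\<forall>c\<in>forms d. (\<forall>r\<in>R. (\<Sum>\<alpha>\<in>mons d. c \<alpha> * r w \<alpha>) = 0) \<longrightarrow> c = (\<lambda>_. 0)))"
  proof (rule forms_kernel_open)
    show "poly_fun (\<lambda>w. r w \<alpha>)" if "r \<in> R" for r \<alpha>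
      using that by (auto simp: R_def line_through_def intro!: poly_fun_mon poly_fun.intros poly_fun_seg)
    show "c = (\<lambda>_. 0)" if "c \<in> forms d" "\<And>r. r \<in> R \<Longrightarrow> (\<Sum>\<alpha>\<in>mons d. c \<alpha> * r w0 \<alpha>) = 0" for c
      using assms that unfolding eq by blast
  qed
  then show ?thesis unfolding generic_def eq by blast
qed

text \<open>The residual half of Castelnuovo's argument: the cofactor inherits the vanishing on all
  chords that do not lie on the quadric; for \<open>d < 2\<close> it is zero anyway.\<close>

lemma quadric_residual:
  fixes c :: "(nat \<Rightarrow> nat) \<Rightarrow> 'a::field_char_0"
  assumes c: "c \<in> forms d" and tr: "\<And>i j. i \<le> d \<Longrightarrow> j \<le> d \<Longrightarrow> quadric_trace d c i j = 0"
    and E: "\<And>m n. (m, n) \<in> E \<Longrightarrow> vanishes_on_line d c (pt w m) (pt w n)"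
    and skew: "\<And>m n. (m, n) \<in> E \<Longrightarrow> fst (pt w m) \<noteq> fst (pt w n) \<and> snd (pt w m) \<noteq> snd (pt w n)"
    and good: "d < 2 \<or> good (d - 2) E w"
  shows "c = (\<lambda>_. 0)"
proof -
  obtain g where g: "g \<in> forms (d - 2)" "d < 2 \<Longrightarrow> g = (\<lambda>_. 0)"
    "\<And>x. evalF d c x = quadric x * evalF (d - 2) g x"
    using quadric_divides[OF tr] by blast
  have "vanishes_on_line (d - 2) g (pt w m) (pt w n)" if "(m, n) \<in> E" for m n
    using vanishes_on_line_quotient[OF g(3) E] that skew by blast
  then have "g = (\<lambda>_. 0)" using good g(1,2) unfolding good_def by blast
  then have "evalF d c x = 0" for x unfolding g(3) by (simp add: evalF_def)
  then show ?thesis using forms_zero_function c by blast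
qed

section \<open>Traces on the quadric\<close>

text \<open>The vertices in V prescribe lines of the ruling, those in S and D simple and double points; the
  points in K do not move with the configuration.\<close>

definition trace_good ::
  "nat \<Rightarrow> nat set \<Rightarrow> nat set \<Rightarrow> nat set \<Rightarrow> ('a \<times> 'a) set \<Rightarrow> (nat \<times> bool \<Rightarrow> 'a::field) \<Rightarrow> bool" where
  "trace_good d V S D K w \<longleftrightarrow> (\<forall>e.
     (\<forall>n\<in>V. \<forall>b. biform d e (w (n, False), b) = 0) \<longrightarrow>
     (\<forall>n\<in>S. biform d e (pt w n) = 0) \<longrightarrow>
     (\<forall>n\<in>D. biform d e (pt w n) = 0 \<and> biform_da d e (pt w n) = 0 \<and> biform_db d e (pt w n) = 0) \<longrightarrow>
     (\<forall>P\<in>K. biform d e P = 0) \<longrightarrow> (\<forall>i\<le>d. \<forall>j\<le>d. e i j = 0))"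

lemma trace_goodD:
  assumes "trace_good d V S D K w"
    and "\<And>n b. n \<in> V \<Longrightarrow> biform d e (w (n, False), b) = 0" "\<And>n. n \<in> S \<Longrightarrow> biform d e (pt w n) = 0"
    and "\<And>n. n \<in> D \<Longrightarrow> biform d e (pt w n) = 0 \<and> biform_da d e (pt w n) = 0 \<and> biform_db d e (pt w n) = 0"
    and "\<And>P. P \<in> K \<Longrightarrow> biform d e P = 0"
  shows "\<forall>i\<le>d. \<forall>j\<le>d. e i j = 0"
  using assms(1)[unfolded trace_good_def, THEN spec[of _ e]] assms(2-5) by simp

lemma double_sum_kernel_open:
  fixes H :: "(('v \<Rightarrow> 'a::field) \<Rightarrow> nat \<Rightarrow> nat \<Rightarrow> 'a) set"
  assumes poly: "\<And>h i j. h \<in> H \<Longrightarrow> poly_fun (\<lambda>w. h w i j)"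
    and w0: "\<And>e i j. (\<And>h. h \<in> H \<Longrightarrow> (\<Sum>i\<le>d. \<Sum>j\<le>d. e i j * h w0 i j) = 0) \<Longrightarrow>
               i \<le> d \<Longrightarrow> j \<le> d \<Longrightarrow> e i j = 0"
  shows "generic (\<lambda>w. \<forall>e. (\<forall>h\<in>H. (\<Sum>i\<le>d. \<Sum>j\<le>d. e i j * h w i j) = 0) \<longrightarrow>
           (\<forall>i\<le>d. \<forall>j\<le>d. e i j = 0))"
proof -
  let ?R = "(\<lambda>h w (i, j). h w i j) ` H"
  have sum: "(\<Sum>p\<in>{..d} \<times> {..d}. (case p of (i, j) \<Rightarrow> h w i j) * c p) =
      (\<Sum>i\<le>d. \<Sum>j\<le>d. c (i, j) * h w i j)" for h :: "('v \<Rightarrow> 'a) \<Rightarrow> nat \<Rightarrow> nat \<Rightarrow> 'a" and w c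
    by (simp add: sum.cartesian_product split_def mult.commute)
  have "\<exists>G. poly_fun G \<and> G w0 \<noteq> 0 \<and>
      (\<forall>w. G w \<noteq> 0 \<longrightarrow> trivial_kernel ((\<lambda>r. r w) ` ?R) ({..d} \<times> {..d}))"
  proof (rule trivial_kernel_open)
    show "poly_fun (\<lambda>w. r w p)" if "r \<in> ?R" for r p
      using that poly by (cases p) auto
    show "trivial_kernel ((\<lambda>r. r w0) ` ?R) ({..d} \<times> {..d})"
      unfolding trivial_kernel_def
    proof (intro allI impI ballI)
      fix c p
      assume c: "\<forall>r\<in>(\<lambda>r. r w0) ` ?R. (\<Sum>j\<in>{..d} \<times> {..d}. r j * c j) = 0"
        and p: "p \<in> {..d} \<times> {..d}"
      have "(\<Sum>i\<le>d. \<Sum>j\<le>d. c (i, j) * h w0 i j) = 0" if "h \<in> H" for h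
        unfolding sum[symmetric] using bspec[OF c imageI[OF imageI[OF that]]] .
      then show "c p = 0" using w0[of "\<lambda>i j. c (i, j)" "fst p" "snd p"] p by auto
    qed
  qed simp
  then obtain G where G: "poly_fun G" "G w0 \<noteq> 0"
    "\<forall>w. G w \<noteq> 0 \<longrightarrow> trivial_kernel ((\<lambda>r. r w) ` ?R) ({..d} \<times> {..d})" by blast
  show ?thesis
  proof (rule genericI[where G = G, OF G(1,2)], intro allI impI)
    fix w e i j
    assume w: "G w \<noteq> 0" and e: "\<forall>h\<in>H. (\<Sum>i\<le>d. \<Sum>j\<le>d. e i j * h w i j) = 0"
      and ij: "i \<le> d" "j \<le> d"
    have "(\<Sum>p\<in>{..d} \<times> {..d}. r p * (case p of (i, j) \<Rightarrow> e i j)) = 0" if "r \<in> (\<lambda>r. r w) ` ?R" for r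
      using that e by (auto simp: sum)
    then have "(case (i, j) of (i, j) \<Rightarrow> e i j) = 0"
      using trivial_kernelD[where c = "\<lambda>(i, j). e i j" and j = "(i, j)", OF G(3)[rule_format, OF w]] ij by blast
    then show "e i j = 0" by simp
  qed
qed

text \<open>Vanishing on a ruling line is encoded by one row for each value \<open>b\<close>; the
  rows from \<open>K\<close> are constant in \<open>w\<close>.\<close>

lemma trace_good_generic:
  fixes w0 :: "nat \<times> bool \<Rightarrow> 'a::field"
  assumes "trace_good d V S D K w0"
  shows "generic (\<lambda>w :: nat \<times> bool \<Rightarrow> 'a. trace_good d V S D K w)"
proof -
  define H :: "((nat \<times> bool \<Rightarrow> 'a) \<Rightarrow> nat \<Rightarrow> nat \<Rightarrow> 'a) set" where
    "H = (\<lambda>(n, b) w i j. w (n, False) ^ i * b ^ j) ` (V \<times> UNIV)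
       \<union> (\<lambda>n w i j. w (n, False) ^ i * w (n, True) ^ j) ` (S \<union> D)
       \<union> (\<lambda>n w i j. of_nat i * w (n, False) ^ (i - 1) * w (n, True) ^ j) ` D
       \<union> (\<lambda>n w i j. w (n, False) ^ i * (of_nat j * w (n, True) ^ (j - 1))) ` D
       \<union> (\<lambda>P w i j. fst P ^ i * snd P ^ j) ` K"
  have eq: "trace_good d V S D K w \<longleftrightarrow> (\<forall>e. (\<forall>h\<in>H. (\<Sum>i\<le>d. \<Sum>j\<le>d. e i j * h w i j) = 0) \<longrightarrow>
           (\<forall>i\<le>d. \<forall>j\<le>d. e i j = 0))" for w
  proof -
    have rows: "(\<forall>h\<in>H. (\<Sum>i\<le>d. \<Sum>j\<le>d. e i j * h w i j) = 0) \<longleftrightarrow>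
      (\<forall>n\<in>V. \<forall>b. biform d e (w (n, False), b) = 0) \<and> (\<forall>n\<in>S. biform d e (pt w n) = 0) \<and>
      (\<forall>n\<in>D. biform d e (pt w n) = 0 \<and> biform_da d e (pt w n) = 0 \<and> biform_db d e (pt w n) = 0) \<and>
      (\<forall>P\<in>K. biform d e P = 0)" for e
      unfolding H_def ball_Un ball_simps(9) split_paired_Ball_Sigma biform_def biform_da_def biform_db_def
        pt_def fst_conv snd_conv prod.case by blast
    show ?thesis by (simp only: trace_good_def rows imp_conjL)
  qed
  have poly: "poly_fun (\<lambda>w. h w i j)" if "h \<in> H" for h i j
    using that unfolding H_def by (elim UnE imageE) (auto intro!: poly_fun.intros poly_fun_power)
  show ?thesis
    unfolding eq
  proof (rule double_sum_kernel_open[where H = H and ?w0.0 = w0 and d = d])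
    show "poly_fun (\<lambda>w. h w i j)" if "h \<in> H" for h i j using that by (rule poly)
    show "e i j = 0" if "\<And>h. h \<in> H \<Longrightarrow> (\<Sum>i\<le>d. \<Sum>j\<le>d. e i j * h w0 i j) = 0" "i \<le> d" "j \<le> d" for e i j
      using assms[unfolded eq] that by auto
  qed
qed

section \<open>Placing the points of the trace on a grid\<close>

text \<open>With the first coordinate fixed, a biform is a polynomial of degree at most
  \<open>d\<close> in the second one; the zeros in \<open>D\<close> count twice.\<close>

lemma biform_column:
  fixes e :: "nat \<Rightarrow> nat \<Rightarrow> 'a::field_char_0"
  assumes "finite Z" "D \<subseteq> Z" "\<And>b. b \<in> Z \<Longrightarrow> biform d e (a, b) = 0"
    and "\<And>b. b \<in> D \<Longrightarrow> biform_db d e (a, b) = 0" and "d < card Z + card D"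
  shows "biform d e (a, b) = 0"
proof -
  let ?c = "\<lambda>j. \<Sum>i\<le>d. e i j * a ^ i"
  have eq: "biform d e (a, b) = (\<Sum>j\<le>d. ?c j * b ^ j)"
    "biform_db d e (a, b) = (\<Sum>j\<le>d. ?c j * (of_nat j * b ^ (j - 1)))" for b
    unfolding biform_def biform_db_def fst_conv snd_conv
    by (subst sum.swap; simp add: sum_distrib_right mult.assoc)+
  have "?c j = 0" if "j \<le> d" for j
    by (rule power_sum_eq_zero[OF assms(1,2) _ _ assms(5) that]) (use assms(3,4) in \<open>auto simp: eq\<close>)
  then show ?thesis unfolding eq by simp
qed

lemma biform_row_coeff:
  fixes e :: "nat \<Rightarrow> nat \<Rightarrow> 'a::field_char_0"
  assumes "finite Z" "D \<subseteq> Z" "\<And>a. a \<in> Z \<Longrightarrow> biform d e (a, b) = 0"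
    and "\<And>a. a \<in> D \<Longrightarrow> biform_da d e (a, b) = 0" and "d < card Z + card D" and "i \<le> d"
  shows "(\<Sum>j\<le>d. e i j * b ^ j) = 0"
proof -
  let ?c = "\<lambda>i. \<Sum>j\<le>d. e i j * b ^ j"
  have eq: "biform d e (a, b) = (\<Sum>i\<le>d. ?c i * a ^ i)"
    "biform_da d e (a, b) = (\<Sum>i\<le>d. ?c i * (of_nat i * a ^ (i - 1)))" for a
    unfolding biform_def biform_da_def fst_conv snd_conv
    by (simp_all add: sum_distrib_left algebra_simps)
  show ?thesis
    by (rule power_sum_eq_zero[OF assms(1,2) _ _ assms(5,6)]) (use assms(3,4) in \<open>auto simp: eq\<close>)
qed

lemma biform_row:
  fixes e :: "nat \<Rightarrow> nat \<Rightarrow> 'a::field_char_0"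
  assumes "finite Z" "D \<subseteq> Z" "\<And>a. a \<in> Z \<Longrightarrow> biform d e (a, b) = 0"
    and "\<And>a. a \<in> D \<Longrightarrow> biform_da d e (a, b) = 0" and "d < card Z + card D"
  shows "biform d e (a, b) = 0"
proof -
  have "biform d e (a, b) = (\<Sum>i\<le>d. (\<Sum>j\<le>d. e i j * b ^ j) * a ^ i)"
    unfolding biform_def fst_conv snd_conv by (simp add: sum_distrib_left algebra_simps)
  then show ?thesis using biform_row_coeff[OF assms] by simp
qed

lemma biform_columns_zero:
  fixes e :: "nat \<Rightarrow> nat \<Rightarrow> 'a::field_char_0"
  assumes col: "\<And>i b. i \<le> d \<Longrightarrow> biform d e (of_nat i, b) = 0" and "i \<le> d" "j \<le> d"
  shows "e i j = 0"
proof -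
  have card: "card (of_nat ` {..d} :: 'a set) = Suc d"
    by (simp add: card_image inj_on_def)
  have 0: "(\<Sum>j\<le>d. e i j * b ^ j) = 0" for b
    by (rule biform_row_coeff[of "of_nat ` {..d}" "{}"]) (use assms card in auto)
  show ?thesis
    by (rule power_sum_eq_zero[where e = "e i", of "of_nat ` {..d}" "{}"]) (use 0 assms card in auto)
qed

abbreviation nat_point :: "nat \<times> nat \<Rightarrow> 'a::semiring_1 \<times> 'a" where
  "nat_point p \<equiv> (of_nat (fst p), of_nat (snd p))"

text \<open>The vertices in \<open>S\<close> only have to cover \<open>T\<close>, in whatever order;
  surplus ones may land anywhere.\<close>

lemma place_points:
  assumes "finite T" "finite S" "card T \<le> card S" "V \<inter> S = {}"
  obtains w :: "nat \<times> bool \<Rightarrow> 'a::semiring_1" where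
    "\<And>n. n \<in> V \<Longrightarrow> pt w n = nat_point (\<phi> n)" "nat_point ` T \<subseteq> pt w ` S"
proof -
  obtain h where h: "inj_on h T" "h ` T \<subseteq> S"
    using inj_on_iff_card_le[OF assms(1,2)] assms(3) by blast
  define w :: "nat \<times> bool \<Rightarrow> 'a" where
    "w = (\<lambda>(n, c). let p = (if n \<in> V then \<phi> n else inv_into T h n) in of_nat (if c then snd p else fst p))"
  have "nat_point p = pt w (h p)" if "p \<in> T" for p
    using that h assms(4) by (auto simp: w_def pt_def)
  then have "nat_point ` T \<subseteq> pt w ` S" using h(2) by auto
  moreover have "pt w n = nat_point (\<phi> n)" if "n \<in> V" for n
    using that by (simp add: w_def pt_def)
  ultimately show thesis using that by blast
qed

text \<open>The ruling lines are the columns \<open>u\<close>, ..., \<open>d\<close>. Every earlier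
  column contains \<open>d + 1\<close> grid points, supplied by \<open>S\<close> and
  \<open>K\<close>, which is one more than the degree.\<close>

lemma trace_good_grid:
  fixes d :: nat and K :: "(nat \<times> nat) set"
  assumes fin: "finite V" "finite S" and VS: "V \<inter> S = {}" and V: "card V + u = d + 1"
    and S: "card ({..<u} \<times> {..d} - K) \<le> card S"
  shows "\<exists>w :: nat \<times> bool \<Rightarrow> 'a::field_char_0. trace_good d V S {} (nat_point ` K) w"
proof -
  have "card V = card {u..d}" using V by simp
  then obtain \<phi> where \<phi>: "bij_betw \<phi> V {u..d}"
    using finite_same_card_bij[OF fin(1), of "{u..d}"] by auto
  obtain w :: "nat \<times> bool \<Rightarrow> 'a" where
    w: "\<And>n. n \<in> V \<Longrightarrow> pt w n = nat_point (\<phi> n, 0)" "nat_point ` ({..<u} \<times> {..d} - K) \<subseteq> pt w ` S"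
    by (rule place_points[OF _ fin(2) S VS, of "\<lambda>n. (\<phi> n, 0)"]) (simp, blast)
  have "trace_good d V S {} (nat_point ` K) w"
    unfolding trace_good_def
  proof (intro allI impI)
    fix e i j
    assume e: "\<forall>n\<in>V. \<forall>b. biform d e (w (n, False), b) = 0" "\<forall>n\<in>S. biform d e (pt w n) = 0"
      "\<forall>P\<in>nat_point ` K. biform d e P = 0" and ij: "i \<le> d" "j \<le> d"
    have "biform d e (of_nat i, b) = 0" if "i \<le> d" for i b
    proof (cases "i < u")
      case True
      have grid: "biform d e (of_nat i, of_nat j) = 0" if "j \<le> d" for j
      proof (cases "(i, j) \<in> K")
        case False
        then have "nat_point (i, j) \<in> pt w ` S" using True that w(2) by blast
        then show ?thesis using e(2) by auto
      qed (use e(3) in force)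
      show ?thesis
        by (rule biform_column[of "of_nat ` {..d}" "{}"]) (use grid in \<open>auto simp: card_image inj_on_def\<close>)
    next
      case False
      then have "i \<in> \<phi> ` V" using \<phi> that unfolding bij_betw_def by simp
      then obtain n where n: "n \<in> V" "\<phi> n = i" by blast
      then have "w (n, False) = of_nat i" using w(1)[OF n(1)] by (simp add: pt_def)
      then show ?thesis using e(1) n(1) by metis
    qed
    then show "e i j = 0" using biform_columns_zero ij by blast
  qed
  then show ?thesis by blast
qed

text \<open>The columns \<open>2, \<dots>, k\<close> are filled with simple points. Each of the rows \<open>0, \<dots>, 2 k - 1\<close>
  then contains \<open>3 k\<close> zeros and one double point, so these rows vanish; finally the columns
  0 and 1 contain \<open>k\<close> simple and \<open>k\<close> double zeros on these rows and two more simple points.\<close>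
lemma trace_good_double_points:
  fixes k :: nat
  assumes k: "k \<ge> 1" and d: "d = 3 * k + 1" and fin: "finite V" "finite S"
    and disj: "V \<inter> S = {}" "{..<2 * k} \<inter> S = {}" "V \<inter> {..<2 * k} = {}"
    and V: "card V = 2 * k + 1" and S: "(k - 1) * (3 * k + 2) + 4 \<le> card S"
  shows "\<exists>w :: nat \<times> bool \<Rightarrow> 'a::field_char_0. trace_good d V S {..<2 * k} {} w"
proof -
  have "card V = card {k + 1..d}" using V d by simp
  then obtain \<phi> where \<phi>: "bij_betw \<phi> V {k + 1..d}"
    using finite_same_card_bij[OF fin(1), of "{k + 1..d}"] by auto
  \<comment> \<open>The double points have heights 0, ..., k - 1 in column 0 and k, ..., 2 k - 1 in
    column 1, hence one on each of the first 2 k rows.\<close>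
  let ?\<psi> = "\<lambda>n. if n < k then (0, n) else if n < 2 * k then (1, n) else (\<phi> n, 0 :: nat)"
  \<comment> \<open>k - 1 full columns of 3 k + 2 points, and two further points in each of the
    columns 0 and 1.\<close>
  let ?T = "{2..k} \<times> {..d} \<union> {0, 1} \<times> {2 * k, 2 * k + 1}"
  have "card ?T = (k - 1) * (3 * k + 2) + 4"
    by (subst card_Un_disjoint) (use d in \<open>auto simp: card_cartesian_product\<close>)
  then have T: "card ?T \<le> card S" using S by simp
  obtain w :: "nat \<times> bool \<Rightarrow> 'a" where
    w: "\<And>n. n \<in> V \<union> {..<2 * k} \<Longrightarrow> pt w n = nat_point (?\<psi> n)" "nat_point ` ?T \<subseteq> pt w ` S"
    by (rule place_points[OF _ fin(2) T, of "V \<union> {..<2 * k}" ?\<psi>]) (simp, use disj in blast, blast)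
  have "trace_good d V S {..<2 * k} {} w"
    unfolding trace_good_def
  proof (intro allI impI)
    fix e i j
    assume e: "\<forall>n\<in>V. \<forall>b. biform d e (w (n, False), b) = 0" "\<forall>n\<in>S. biform d e (pt w n) = 0"
      "\<forall>n\<in>{..<2 * k}. biform d e (pt w n) = 0 \<and> biform_da d e (pt w n) = 0 \<and> biform_db d e (pt w n) = 0"
      and ij: "i \<le> d" "j \<le> d"
    have card: "card (of_nat ` A :: 'a set) = card A" for A :: "nat set"
      by (simp add: card_image inj_on_def)
    have S0: "biform d e (of_nat i, of_nat j) = 0" if "(i, j) \<in> ?T" for i j
    proof -
      have "nat_point (i, j) \<in> pt w ` S" using w(2) that by blast
      then show ?thesis using e(2) by auto
    qed
    have D0: "biform d e (nat_point (?\<psi> n)) = 0" "biform_da d e (nat_point (?\<psi> n)) = 0"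
      "biform_db d e (nat_point (?\<psi> n)) = 0" if "n < 2 * k" for n
    proof -
      have n: "n \<in> {..<2 * k}" using that by simp
      have "pt w n = nat_point (?\<psi> n)" by (rule w(1)) (use n in blast)
      with bspec[OF e(3) n] show "biform d e (nat_point (?\<psi> n)) = 0"
        "biform_da d e (nat_point (?\<psi> n)) = 0" "biform_db d e (nat_point (?\<psi> n)) = 0"
        by simp_all
    qed
    have high: "biform d e (of_nat i, b) = 0" if "k + 1 \<le> i" "i \<le> d" for i b
    proof -
      have "i \<in> \<phi> ` V" using \<phi> that unfolding bij_betw_def by simp
      then obtain n where n: "n \<in> V" "\<phi> n = i" by blast
      then have "n \<notin> {..<2 * k}" using disj(3) by blast
      then have "w (n, False) = of_nat i" using w(1)[of n] n by (simp add: pt_def)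
      then show ?thesis using e(1) n(1) by metis
    qed
    have middle: "biform d e (of_nat i, b) = 0" if "2 \<le> i" "i \<le> k" for i b
      by (rule biform_column[of "of_nat ` {..d}" "{}"]) (use S0 that in \<open>auto simp: card\<close>)
    \<comment> \<open>Each double point is used twice: here through its derivative along the row, in
      \<open>low\<close> through the one along the column.\<close>
    have row: "biform d e (a, of_nat n) = 0" if n: "n < 2 * k" for n a
    proof (rule biform_row[of "of_nat ` insert (fst (?\<psi> n)) {2..d}" "{of_nat (fst (?\<psi> n))}"])
      fix a :: 'a assume "a \<in> of_nat ` insert (fst (?\<psi> n)) {2..d}"
      then obtain i where i: "a = of_nat i" "i = fst (?\<psi> n) \<or> 2 \<le> i \<and> i \<le> d" by auto
      then consider "i = fst (?\<psi> n)" | "2 \<le> i" "i \<le> k" | "k + 1 \<le> i" "i \<le> d" by linarith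
      then show "biform d e (a, of_nat n) = 0"
      proof cases
        case 1
        then show ?thesis using D0(1)[OF n] n i by (auto split: if_splits)
      qed (use high middle i in auto)
    next
      show "biform_da d e (a, of_nat n) = 0" if "a \<in> {of_nat (fst (?\<psi> n))}" for a
        using D0(2)[OF n] n that by (auto split: if_splits)
      have "card (insert (fst (?\<psi> n)) {2..d}) = d" using n d k by (subst card_insert_disjoint) auto
      then show "d < card (of_nat ` insert (fst (?\<psi> n)) {2..d} :: 'a set) + card {of_nat (fst (?\<psi> n)) :: 'a}"
        unfolding card by simp
    qed auto
    have low: "biform d e (of_nat i, b) = 0" if i: "i < 2" for i b
    proof (rule biform_column[of "of_nat ` {..2 * k + 1}" "of_nat ` (if i = 0 then {..<k} else {k..<2 * k})"])
      show "of_nat ` (if i = 0 then {..<k} else {k..<2 * k}) \<subseteq> (of_nat ` {..2 * k + 1} :: 'a set)"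
        by (intro image_mono) auto
      show "biform d e (of_nat i, b) = 0" if "b \<in> of_nat ` {..2 * k + 1}" for b
      proof -
        obtain n where n: "b = of_nat n" "n \<le> 2 * k + 1" using \<open>b \<in> _\<close> by auto
        then consider "n < 2 * k" | "n = 2 * k \<or> n = 2 * k + 1" by linarith
        then show ?thesis
        proof cases
          case 1
          then show ?thesis using row n by simp
        next
          case 2
          then have "(i, n) \<in> ?T" using i by auto
          then show ?thesis using S0 n by blast
        qed
      qed
      show "biform_db d e (of_nat i, b) = 0" if "b \<in> of_nat ` (if i = 0 then {..<k} else {k..<2 * k})" for b
      proof -
        obtain n where n: "b = of_nat n" "n \<in> (if i = 0 then {..<k} else {k..<2 * k})"
          using \<open>b \<in> _\<close> by auto
        then show ?thesis using D0(3)[of n] i by (auto split: if_splits simp: less_2_cases_iff)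
      qed
      show "d < card (of_nat ` {..2 * k + 1} :: 'a set)
          + card (of_nat ` (if i = 0 then {..<k} else {k..<2 * k}) :: 'a set)"
        unfolding card using d by auto
    qed auto
    have "biform d e (of_nat i, b) = 0" if i: "i \<le> d" for i b
    proof -
      consider "i < 2" | "2 \<le> i" "i \<le> k" | "k + 1 \<le> i" "i \<le> d" using i by linarith
      then show ?thesis by cases (use low middle high in auto)
    qed
    then show "e i j = 0" using biform_columns_zero ij by blast
  qed
  then show ?thesis by blast
qed

section \<open>Castelnuovo steps\<close>

definition matching :: "nat \<Rightarrow> (nat \<times> nat) set" where
  "matching l = (\<lambda>i. (2 * i, 2 * i + 1)) ` {..<l}"

text \<open>For \<open>i < k\<close> the edge \<open>(2 i, 2 i + 1)\<close> and the pendant edges at its two ends form a chain of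
  three lines.\<close>

definition chain_graph :: "nat \<Rightarrow> nat \<Rightarrow> (nat \<times> nat) set" where
  "chain_graph M k = matching M \<union> (\<lambda>j. (j, 2 * M + j)) ` {..<2 * k}"

text \<open>Skew refers to the rulings: no edge may have its line on the quadric. Edges sharing a
  vertex are allowed.\<close>

definition skew_edges :: "(nat \<times> nat) set \<Rightarrow> (nat \<times> bool \<Rightarrow> 'a) \<Rightarrow> bool" where
  "skew_edges E w \<longleftrightarrow>
     (\<forall>(m, n)\<in>E. fst (pt w m) \<noteq> fst (pt w n) \<and> snd (pt w m) \<noteq> snd (pt w n))"

lemma generic_distinct:
  assumes "v \<noteq> v'"
  shows "generic (\<lambda>w :: 'v \<Rightarrow> 'a::field_char_0. w v \<noteq> w v')"
  by (rule genericI[of "\<lambda>w. w v - w v'" "\<lambda>u. if u = v then 1 else 0"])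
    (use assms in \<open>auto intro: poly_fun_intros\<close>)

lemma skew_edges_generic:
  assumes "finite E" "\<And>m n. (m, n) \<in> E \<Longrightarrow> m \<noteq> n"
  shows "generic (\<lambda>w :: nat \<times> bool \<Rightarrow> 'a::field_char_0. skew_edges E w)"
proof -
  have "generic (\<lambda>w :: nat \<times> bool \<Rightarrow> 'a. \<forall>e\<in>E. w (fst e, False) \<noteq> w (snd e, False) \<and> w (fst e, True) \<noteq> w (snd e, True))"
    by (intro generic_ball generic_conj generic_distinct) (use assms in auto)
  then show ?thesis by (simp add: skew_edges_def pt_def split_def)
qed

lemma finite_matching: "finite (matching l)" and finite_chain_graph: "finite (chain_graph M k)"
  by (simp_all add: matching_def chain_graph_def)

lemma matching_irrefl: "(m, n) \<in> matching l \<Longrightarrow> m \<noteq> n"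
  by (auto simp: matching_def)

lemma matching_vertex:
  assumes "n < 2 * l" "\<And>m m'. (m, m') \<in> matching l \<Longrightarrow> vanishes_on_line d c (pt w m) (pt w m')"
  shows "evalF d c (seg (pt w n)) = 0"
proof -
  have "(2 * (n div 2), 2 * (n div 2) + 1) \<in> matching l" using assms(1) by (auto simp: matching_def)
  from vanishes_on_lineD[OF assms(2)[OF this]]
  have "evalF d c (seg (pt w (2 * (n div 2)))) = 0" "evalF d c (seg (pt w (2 * (n div 2) + 1))) = 0" .
  moreover have "n = 2 * (n div 2) \<or> n = 2 * (n div 2) + 1" by presburger
  ultimately show ?thesis by metis
qed

lemma biform_ruling:
  assumes "vanishes_on_line d c (pt w m) (pt w n)" "fst (pt w m) = a" "fst (pt w n) = a"
    and "snd (pt w m) \<noteq> snd (pt w n)"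
  shows "biform d (quadric_trace d c) (a, b) = 0"
  using vanishes_on_ruling[of d c a "snd (pt w m)" "snd (pt w n)" b] assms
  by (metis evalF_seg prod.collapse)

text \<open>The \<open>r\<close> new lines lie on the quadric and drop out of the residual problem;
  the \<open>l\<close> old chords provide \<open>2 * l\<close> trace points for the \<open>u\<close>
  remaining columns. The points of \<open>K\<close> concern only the trace. One \<open>w\<close>
  serves both problems because each condition is generic.\<close>

lemma add_ruling_lines_and_points:
  fixes d l r :: nat and K :: "(nat \<times> nat) set"
  assumes good: "d < 2 \<or> (\<exists>w :: nat \<times> bool \<Rightarrow> 'a::field_char_0. good (d - 2) (matching l) w)"
    and r: "r + u = d + 1" and K: "card ({..<u} \<times> {..d} - K) \<le> 2 * l"
  shows "\<exists>w :: nat \<times> bool \<Rightarrow> 'a. \<forall>c\<in>forms d.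
    (\<forall>(m, n)\<in>matching (l + r). vanishes_on_line d c (pt w m) (pt w n)) \<longrightarrow>
    (\<forall>P\<in>nat_point ` K. evalF d c (seg P) = 0) \<longrightarrow> c = (\<lambda>_. 0)"
proof -
  \<comment> \<open>A new line is recorded by its even vertex, whose first coordinate selects the
    ruling line.\<close>
  let ?V = "(\<lambda>i. 2 * i) ` {l..<l + r}" and ?S = "{..<2 * l}"
  have "card ?V = r" by (subst card_image) (auto simp: inj_on_def)
  then have "\<exists>w :: nat \<times> bool \<Rightarrow> 'a. trace_good d ?V ?S {} (nat_point ` K) w"
    using r K by (intro trace_good_grid[where u = u]) auto
  then obtain w1 :: "nat \<times> bool \<Rightarrow> 'a" where "trace_good d ?V ?S {} (nat_point ` K) w1" by blast
  then have gt: "generic (\<lambda>w :: nat \<times> bool \<Rightarrow> 'a. trace_good d ?V ?S {} (nat_point ` K) w)"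
    by (rule trace_good_generic)
  have gg: "generic (\<lambda>w :: nat \<times> bool \<Rightarrow> 'a. d < 2 \<or> good (d - 2) (matching l) w)"
  proof (cases "d < 2")
    case True
    then show ?thesis by (intro genericI[of "\<lambda>_. 1"]) (auto intro: poly_fun.intros)
  next
    case False
    with good obtain w0 :: "nat \<times> bool \<Rightarrow> 'a" where "good (d - 2) (matching l) w0" by blast
    from good_generic[OF this] False show ?thesis by simp
  qed
  have gs: "generic (\<lambda>w :: nat \<times> bool \<Rightarrow> 'a. skew_edges (matching l) w)"
    by (rule skew_edges_generic[OF finite_matching matching_irrefl])
  obtain w :: "nat \<times> bool \<Rightarrow> 'a" where w: "trace_good d ?V ?S {} (nat_point ` K) w"
    "d < 2 \<or> good (d - 2) (matching l) w" "skew_edges (matching l) w"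
    using generic_witness[OF generic_conj[OF gt generic_conj[OF gg gs]]] by blast
  \<comment> \<open>The odd ends of the new edges move onto the ruling lines through their even
    ends; the shift by 1 keeps the two ends distinct. Vertices below \<open>2 * l\<close> stay in
    place.\<close>
  define w' where "w' = (\<lambda>(n, c). if n < 2 * l \<or> even n then w (n, c)
    else if c then w (n - 1, True) + 1 else w (n - 1, False))"
  have low: "pt w' n = pt w n" if "n < 2 * l" for n using that by (simp add: w'_def pt_def)
  show ?thesis
  proof (intro exI[of _ w'] ballI impI)
    fix c :: "(nat \<Rightarrow> nat) \<Rightarrow> 'a"
    assume c: "c \<in> forms d" and "\<forall>(m, n)\<in>matching (l + r). vanishes_on_line d c (pt w' m) (pt w' n)"
      and cK: "\<forall>P\<in>nat_point ` K. evalF d c (seg P) = 0"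
    then have E: "vanishes_on_line d c (pt w' m) (pt w' n)" if "(m, n) \<in> matching (l + r)" for m n
      using that by blast
    have E': "vanishes_on_line d c (pt w m) (pt w n)" if "(m, n) \<in> matching l" for m n
    proof -
      have "(m, n) \<in> matching (l + r)" "m < 2 * l" "n < 2 * l" using that by (auto simp: matching_def)
      then show ?thesis using E[of m n] low by simp
    qed
    have "\<forall>i\<le>d. \<forall>j\<le>d. quadric_trace d c i j = 0"
    proof (rule trace_goodD[OF w(1)])
      show "biform d (quadric_trace d c) (w (n, False), b) = 0" if n: "n \<in> ?V" for n b
      proof -
        have "(n, n + 1) \<in> matching (l + r)" "2 * l \<le> n" "even n" using n by (auto simp: matching_def)
        then show ?thesis
          by (intro biform_ruling[OF E]) (auto simp: pt_def w'_def)
      qed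
      show "biform d (quadric_trace d c) (pt w n) = 0" if "n \<in> ?S" for n
        using matching_vertex[of n l d c w] E' that by (simp add: evalF_seg)
      show "biform d (quadric_trace d c) P = 0" if "P \<in> nat_point ` K" for P
        using bspec[OF cK that] by (simp add: evalF_seg)
    qed auto
    then show "c = (\<lambda>_. 0)"
      using w(2,3) E' by (intro quadric_residual[OF c, where E = "matching l" and w = w]) (auto simp: skew_edges_def)
  qed
qed

lemma add_ruling_lines:
  fixes d l r :: nat
  assumes "d < 2 \<or> (\<exists>w :: nat \<times> bool \<Rightarrow> 'a::field_char_0. good (d - 2) (matching l) w)"
    and "r + u = d + 1" and "u * (d + 1) \<le> 2 * l"
  shows "\<exists>w :: nat \<times> bool \<Rightarrow> 'a. good d (matching (l + r)) w"
proof -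
  have "card ({..<u} \<times> {..d} - {}) \<le> 2 * l" using assms(3) by (simp add: card_cartesian_product)
  from add_ruling_lines_and_points[OF assms(1,2) this] show ?thesis
    unfolding good_def by simp
qed

text \<open>\<open>l\<close> is the line count of degree \<open>3 * k - 3\<close>. The
  \<open>2 * k\<close> pendant edges and one extra edge become ruling lines, leaving
  \<open>k - 1\<close> columns. The vertices below \<open>2 * k\<close> already lie on these lines,
  and the other \<open>2 * l - 2 * k = (k - 1) * (3 * k)\<close> are exactly enough.\<close>

lemma chain_graph_good:
  fixes k l :: nat
  assumes k: "k \<ge> 1" and l: "2 * l = (3 * k - 1) * k"
    and good: "\<exists>w :: nat \<times> bool \<Rightarrow> 'a::field_char_0. good (3 * k - 3) (matching l) w"
  shows "\<exists>w :: nat \<times> bool \<Rightarrow> 'a. good (3 * k - 1) (chain_graph (l + 1) k) w"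
proof -
  let ?d = "3 * k - 1" and ?V = "insert (2 * l) {..<2 * k}" and ?S = "{2 * k..<2 * l}"
  have "2 * k \<le> (3 * k - 1) * k" using k by (intro mult_right_mono) auto
  then have kl: "k \<le> l" unfolding l[symmetric] by simp
  have d2: "?d - 2 = 3 * k - 3" by simp
  have "card ?V = 2 * k + 1" using kl by simp
  then have cV: "card ?V + (k - 1) = ?d + 1" using k by simp
  have "(k - 1) * (3 * k) + 2 * k = (3 * k - 1) * k"
    using k by (cases k) (simp_all add: algebra_simps)
  then have "(k - 1) * (3 * k) \<le> 2 * l - 2 * k" unfolding l[symmetric] by linarith
  then have cS: "card ({..<k - 1} \<times> {..?d} - {}) \<le> card ?S" using k by (simp add: card_cartesian_product)
  have "\<exists>w :: nat \<times> bool \<Rightarrow> 'a. trace_good ?d ?V ?S {} (nat_point ` {}) w"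
    by (rule trace_good_grid[OF _ _ _ cV cS]) auto
  then obtain w1 :: "nat \<times> bool \<Rightarrow> 'a" where "trace_good ?d ?V ?S {} {} w1" by auto
  then have gt: "generic (\<lambda>w :: nat \<times> bool \<Rightarrow> 'a. trace_good ?d ?V ?S {} {} w)"
    by (rule trace_good_generic)
  have gg: "generic (\<lambda>w :: nat \<times> bool \<Rightarrow> 'a. good (3 * k - 3) (matching l) w)"
    using good good_generic by blast
  have gs: "generic (\<lambda>w :: nat \<times> bool \<Rightarrow> 'a. skew_edges (matching l) w)"
    by (rule skew_edges_generic[OF finite_matching matching_irrefl])
  obtain w :: "nat \<times> bool \<Rightarrow> 'a" where w: "trace_good ?d ?V ?S {} {} w"
    "good (3 * k - 3) (matching l) w" "skew_edges (matching l) w"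
    using generic_witness[OF generic_conj[OF gt generic_conj[OF gg gs]]] by blast
  \<comment> \<open>\<open>m\<close> is the vertex whose ruling line is joined: \<open>2 * l\<close>
    for the second end of the extra edge, and \<open>j\<close> for the free end
    \<open>2 * (l + 1) + j\<close> of a pendant edge.\<close>
  define w' where "w' = (\<lambda>(n, c). if n \<le> 2 * l then w (n, c)
    else let m = (if n = 2 * l + 1 then 2 * l else n - 2 * (l + 1)) in
      if c then w (m, True) + 1 else w (m, False))"
  have low: "pt w' n = pt w n" if "n < 2 * l" for n using that by (simp add: w'_def pt_def)
  have "good ?d (chain_graph (l + 1) k) w'"
    unfolding good_def
  proof (intro ballI impI)
    fix c :: "(nat \<Rightarrow> nat) \<Rightarrow> 'a"
    assume c: "c \<in> forms ?d" and "\<forall>(m, n)\<in>chain_graph (l + 1) k. vanishes_on_line ?d c (pt w' m) (pt w' n)"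
    then have E: "vanishes_on_line ?d c (pt w' m) (pt w' n)" if "(m, n) \<in> chain_graph (l + 1) k" for m n
      using that by blast
    have E': "vanishes_on_line ?d c (pt w m) (pt w n)" if "(m, n) \<in> matching l" for m n
    proof -
      have "(m, n) \<in> chain_graph (l + 1) k" "m < 2 * l" "n < 2 * l"
        using that by (auto simp: matching_def chain_graph_def)
      then show ?thesis using E[of m n] low by simp
    qed
    have "\<forall>i\<le>?d. \<forall>j\<le>?d. quadric_trace ?d c i j = 0"
    proof (rule trace_goodD[OF w(1)])
      show "biform ?d (quadric_trace ?d c) (w (n, False), b) = 0" if n: "n \<in> ?V" for n b
      proof (cases "n = 2 * l")
        case True
        have "(2 * l, 2 * l + 1) \<in> chain_graph (l + 1) k" by (auto simp: chain_graph_def matching_def)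
        from E[OF this] True show ?thesis
          by (intro biform_ruling[of ?d c w' "2 * l" "2 * l + 1"]) (auto simp: pt_def w'_def)
      next
        case False
        then have n: "n < 2 * k" using n by simp
        then have "(n, 2 * (l + 1) + n) \<in> chain_graph (l + 1) k" by (auto simp: chain_graph_def)
        from E[OF this] n kl show ?thesis
          by (intro biform_ruling[of ?d c w' n "2 * (l + 1) + n"]) (auto simp: pt_def w'_def)
      qed
      show "biform ?d (quadric_trace ?d c) (pt w n) = 0" if "n \<in> ?S" for n
        using matching_vertex[of n l ?d c w] E' that by (simp add: evalF_seg)
    qed auto
    then show "c = (\<lambda>_. 0)"
      using w(2,3) E' unfolding d2[symmetric]
      by (intro quadric_residual[OF c, where E = "matching l" and w = w]) (auto simp: skew_edges_def)
  qed
  then show ?thesis by blast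
qed

section \<open>First-order conditions and the degeneration to chains\<close>

text \<open>\<open>L\<close> is the differential of \<open>f\<close> at \<open>x\<close>; its
  linearity and the expansion in every direction are built up along the generation of
  \<open>f\<close>.\<close>

lemma poly_fun_first_order:
  fixes f :: "('v \<Rightarrow> 'a::comm_ring_1) \<Rightarrow> 'a"
  assumes "poly_fun f"
  shows "\<exists>L. (\<forall>u v s. L (\<lambda>m. u m + s * v m) = L u + s * L v) \<and>
    (\<forall>v. \<exists>h. \<forall>r. f (\<lambda>m. x m + r * v m) = poly (pCons (f x) (pCons (L v) h)) r)"
  using assms
proof induction
  case (pf_const c)
  show ?case by (intro exI[of _ "\<lambda>_. 0"] conjI allI exI[of _ 0]) simp_all
next
  case (pf_var i)
  show ?case by (intro exI[of _ "\<lambda>v. v i"] conjI allI exI[of _ 0]) simp_all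
next
  case (pf_add f g)
  then obtain L L' where L: "\<And>u v s. L (\<lambda>m. u m + s * v m) = L u + s * L v"
    "\<And>u v s. L' (\<lambda>m. u m + s * v m) = L' u + s * L' v"
    and h: "\<And>v. \<exists>h. \<forall>r. f (\<lambda>m. x m + r * v m) = poly (pCons (f x) (pCons (L v) h)) r"
    "\<And>v. \<exists>h. \<forall>r. g (\<lambda>m. x m + r * v m) = poly (pCons (g x) (pCons (L' v) h)) r"
    by blast
  show ?case
  proof (intro exI[of _ "\<lambda>v. L v + L' v"] conjI allI)
    fix v
    obtain h1 h2 where "\<forall>r. f (\<lambda>m. x m + r * v m) = poly (pCons (f x) (pCons (L v) h1)) r"
      "\<forall>r. g (\<lambda>m. x m + r * v m) = poly (pCons (g x) (pCons (L' v) h2)) r" using h by metis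
    then show "\<exists>h. \<forall>r. f (\<lambda>m. x m + r * v m) + g (\<lambda>m. x m + r * v m)
        = poly (pCons (f x + g x) (pCons (L v + L' v) h)) r"
      by (intro exI[of _ "h1 + h2"]) (simp add: algebra_simps)
  qed (simp add: L algebra_simps)
next
  case (pf_mult f g)
  then obtain L L' where L: "\<And>u v s. L (\<lambda>m. u m + s * v m) = L u + s * L v"
    "\<And>u v s. L' (\<lambda>m. u m + s * v m) = L' u + s * L' v"
    and h: "\<And>v. \<exists>h. \<forall>r. f (\<lambda>m. x m + r * v m) = poly (pCons (f x) (pCons (L v) h)) r"
    "\<And>v. \<exists>h. \<forall>r. g (\<lambda>m. x m + r * v m) = poly (pCons (g x) (pCons (L' v) h)) r"
    by blast
  show ?case
  proof (intro exI[of _ "\<lambda>v. f x * L' v + g x * L v"] conjI allI)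
    fix v
    obtain h1 h2 where "\<forall>r. f (\<lambda>m. x m + r * v m) = poly (pCons (f x) (pCons (L v) h1)) r"
      "\<forall>r. g (\<lambda>m. x m + r * v m) = poly (pCons (g x) (pCons (L' v) h2)) r" using h by metis
    then show "\<exists>h. \<forall>r. f (\<lambda>m. x m + r * v m) * g (\<lambda>m. x m + r * v m)
        = poly (pCons (f x * g x) (pCons (f x * L' v + g x * L v) h)) r"
      \<comment> \<open>The part of the product of the two expansions from r^2 on, divided by
        r^2.\<close>
      by (intro exI[of _ "[:L v * L' v:] + smult (f x) h2 + smult (g x) h1
            + [:0, 1:] * (smult (L v) h2 + smult (L' v) h1) + [:0, 0, 1:] * (h1 * h2)"])
        (simp add: algebra_simps)
  qed (simp add: L algebra_simps)
qed

text \<open>Both sides are polynomials in \<open>r\<close>, so the linear coefficients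
  agree.\<close>

lemma power_sum_derivative:
  fixes e :: "nat \<Rightarrow> 'a::field_char_0"
  assumes "\<And>r. (\<Sum>i\<le>d. e i * (a + r) ^ i) = poly (pCons u (pCons v h)) r"
  shows "(\<Sum>i\<le>d. e i * (of_nat i * a ^ (i - 1))) = v"
proof -
  define p where "p = (\<Sum>i\<le>d. monom (e i) i)"
  have "poly (pcompose p [:a, 1:]) r = poly (pCons u (pCons v h)) r" for r
    using assms[of r] by (simp add: p_def poly_pcompose poly_sum poly_monom add.commute)
  then have "pcompose p [:a, 1:] = pCons u (pCons v h)" using poly_eq_poly_eq_iff by blast
  then have "poly (pderiv (pcompose p [:a, 1:])) 0 = poly (pderiv (pCons u (pCons v h))) 0" by simp
  then have "poly (pderiv p) a = v"
    by (simp add: pderiv_pcompose pderiv_pCons poly_pcompose)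
  moreover have "pderiv p = (\<Sum>i\<le>d. monom (of_nat i * e i) (i - 1))"
    by (simp add: p_def pderiv_sum pderiv_monom)
  ultimately show ?thesis by (simp add: poly_sum poly_monom algebra_simps)
qed

text \<open>The two lines and the direction of the first ruling span the tangent space at P, so the
  derivative along the second ruling vanishes as well.\<close>
lemma double_point_of_trace:
  fixes c :: "(nat \<Rightarrow> nat) \<Rightarrow> 'a::field_char_0"
  assumes lines: "vanishes_on_line d c P P1" "vanishes_on_line d c P P2"
    and ne: "snd P1 \<noteq> snd P" "snd P2 \<noteq> snd P" "fst P1 \<noteq> fst P2"
    and da: "biform_da d (quadric_trace d c) P = 0"
  shows "biform_db d (quadric_trace d c) P = 0"
proof -
  obtain a b where P: "P = (a, b)" by (cases P)
  let ?f = "evalF d c" and ?x = "seg P"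
  have "poly_fun ?f" by (rule poly_fun_evalF) (rule pf_var)
  then obtain L where L: "\<And>u v s. L (\<lambda>m. u m + s * v m) = L u + s * L v"
    and h: "\<And>v. \<exists>h. \<forall>r. ?f (\<lambda>m. ?x m + r * v m) = poly (pCons (?f ?x) (pCons (L v) h)) r"
    using poly_fun_first_order[of ?f ?x] by blast
  have L0: "L v = 0" if "\<And>r. ?f (\<lambda>m. ?x m + r * v m) = 0" for v
  proof -
    obtain h where "\<forall>r. ?f (\<lambda>m. ?x m + r * v m) = poly (pCons (?f ?x) (pCons (L v) h)) r"
      using h[of v] by blast
    then have "\<forall>r. poly (pCons (?f ?x) (pCons (L v) h)) r = 0" unfolding that by simp
    then have "pCons (?f ?x) (pCons (L v) h) = 0" using poly_all_0_iff_0 by blast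
    then show ?thesis by simp
  qed
  have line: "L (seg P') = 0" if "vanishes_on_line d c P P'" for P'
  proof (rule L0)
    fix r
    have "(\<lambda>m. ?x m + r * seg P' m) = line_through P P' 1 r" by (simp add: line_through_def)
    then show "?f (\<lambda>m. ?x m + r * seg P' m) = 0" using that unfolding vanishes_on_line_def by metis
  qed
  \<comment> \<open>The radial direction: moving along \<open>?x\<close> only rescales the
    point.\<close>
  have Lx: "L ?x = 0"
  proof (rule L0)
    fix r
    have "(\<lambda>m. ?x m + r * ?x m) = line_through P P1 (1 + r) 0" by (simp add: line_through_def algebra_simps)
    then show "?f (\<lambda>m. ?x m + r * ?x m) = 0" using lines(1) unfolding vanishes_on_line_def by metis
  qed
  \<comment> \<open>\<open>va\<close> and \<open>vb\<close> are the derivatives of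
    \<open>seg\<close> in the two coordinates, and \<open>vn\<close> is the mixed second derivative:
    seg (a + A, b + B) = seg (a, b) + A va + B vb + A B vn.\<close>
  define va where "va = (\<lambda>m::nat. if m < 2 then 0 else if m = 2 then 1 else b)"
  define vb where "vb = (\<lambda>m::nat. if m = 1 then 1 else if m < 3 then 0 else a)"
  define vn where "vn = (\<lambda>m::nat. if m < 3 then 0 else 1 :: 'a)"
  let ?e = "quadric_trace d c"
  have La: "L va = 0"
  proof -
    obtain h where h: "\<And>r. ?f (\<lambda>m. ?x m + r * va m) = poly (pCons (?f ?x) (pCons (L va) h)) r"
      using h[of va] by blast
    have "(\<lambda>m. ?x m + r * va m) = seg (a + r, b)" for r
      by (rule ext) (auto simp: P seg_def va_def algebra_simps)
    then have "(\<Sum>i\<le>d. (\<Sum>j\<le>d. ?e i j * b ^ j) * (a + r) ^ i) = poly (pCons (?f ?x) (pCons (L va) h)) r" for r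
      using h[of r] by (simp add: evalF_seg biform_def sum_distrib_left sum_distrib_right algebra_simps)
    then have "(\<Sum>i\<le>d. (\<Sum>j\<le>d. ?e i j * b ^ j) * (of_nat i * a ^ (i - 1))) = L va"
      by (rule power_sum_derivative)
    then show ?thesis
      using da by (simp add: P biform_da_def sum_distrib_left sum_distrib_right algebra_simps)
  qed
  have Lb: "biform_db d ?e P = L vb"
  proof -
    obtain h where h: "\<And>r. ?f (\<lambda>m. ?x m + r * vb m) = poly (pCons (?f ?x) (pCons (L vb) h)) r"
      using h[of vb] by blast
    have "(\<lambda>m. ?x m + r * vb m) = seg (a, b + r)" for r
      by (rule ext) (auto simp: P seg_def vb_def algebra_simps)
    moreover have "(\<Sum>j\<le>d. (\<Sum>i\<le>d. ?e i j * a ^ i) * b' ^ j) = evalF d c (seg (a, b'))" for b'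
      unfolding evalF_seg biform_def fst_conv snd_conv
      by (subst sum.swap) (simp add: sum_distrib_left sum_distrib_right algebra_simps)
    ultimately have "(\<Sum>j\<le>d. (\<Sum>i\<le>d. ?e i j * a ^ i) * (b + r) ^ j) = poly (pCons (?f ?x) (pCons (L vb) h)) r" for r
      using h[of r] by simp
    then have "(\<Sum>j\<le>d. (\<Sum>i\<le>d. ?e i j * a ^ i) * (of_nat j * b ^ (j - 1))) = L vb"
      by (rule power_sum_derivative)
    then show ?thesis
      unfolding P biform_db_def fst_conv snd_conv
      by (subst sum.swap) (simp add: sum_distrib_left sum_distrib_right algebra_simps)
  qed
  \<comment> \<open>Only the terms with \<open>vb\<close> and \<open>vn\<close> survive. The two
    lines give different factors of \<open>L vn\<close>, so first \<open>L vn\<close> and then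
    \<open>L vb\<close> is zero.\<close>
  have key: "L vb + (fst P' - a) * L vn = 0" if "vanishes_on_line d c P P'" "snd P' \<noteq> b" for P'
  proof -
    let ?A = "fst P' - a" and ?B = "snd P' - b"
    have "seg P' = (\<lambda>m. ((?x m + ?A * va m) + ?B * vb m) + (?A * ?B) * vn m)"
      by (rule ext) (auto simp: P seg_def va_def vb_def vn_def algebra_simps)
    then have "L (seg P') = L ?x + ?A * L va + ?B * L vb + (?A * ?B) * L vn"
      by (simp only: L)
    then have "?B * (L vb + ?A * L vn) = 0" using line[OF that(1)] Lx La by (simp add: algebra_simps)
    then show ?thesis using that(2) by simp
  qed
  have "L vb + (fst P1 - a) * L vn = 0" "L vb + (fst P2 - a) * L vn = 0"
    using key lines ne by (auto simp: P)
  moreover have "(fst P1 - fst P2) * L vn = (L vb + (fst P1 - a) * L vn) - (L vb + (fst P2 - a) * L vn)"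
    by (simp add: algebra_simps)
  ultimately have "(fst P1 - fst P2) * L vn = 0" by simp
  then have "L vn = 0" using ne by simp
  then have "L vb = 0" using key[OF lines(1)] ne by (simp add: P)
  then show ?thesis by (simp add: Lb)
qed

lemma line_through_commute: "line_through P P' s t = line_through P' P t s"
  by (simp add: line_through_def add.commute)

lemma vanishes_on_line_commute: "vanishes_on_line d c P P' \<Longrightarrow> vanishes_on_line d c P' P"
  unfolding vanishes_on_line_def by (metis line_through_commute)

lemma sum_quadric_trace_da:
  "biform_da d (quadric_trace d c) P =
   (\<Sum>\<alpha>\<in>mons d. c \<alpha> * (of_nat (\<alpha> 2 + \<alpha> 3) * fst P ^ (\<alpha> 2 + \<alpha> 3 - 1) * snd P ^ (\<alpha> 1 + \<alpha> 3)))"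
  unfolding biform_da_def
  using sum_quadric_trace[of c "\<lambda>i j. of_nat i * fst P ^ (i - 1) * snd P ^ j" d] by simp

definition partner :: "nat \<Rightarrow> nat" where
  "partner j = (if even j then j + 1 else j - 1)"

lemma matching_partner:
  assumes "j < 2 * l"
  shows "(j, partner j) \<in> matching l \<or> (partner j, j) \<in> matching l"
proof (cases "even j")
  case True
  then obtain i where "j = 2 * i" by (rule evenE)
  then show ?thesis using assms by (auto simp: matching_def partner_def)
next
  case False
  then obtain i where "j = 2 * i + 1" by (rule oddE)
  then show ?thesis using assms by (auto simp: matching_def partner_def)
qed

lemma partner_less: "j < 2 * k \<Longrightarrow> partner j < 2 * k"
  by (auto simp: partner_def elim!: evenE)

text \<open>Vertex \<open>2 (M + j)\<close> is the vertex \<open>j\<close> displaced by \<open>t\<close> and \<open>2 (M + j) + 1\<close> is the free end of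
  the pendant edge at \<open>j\<close>; the pairs from \<open>j = 2 k\<close> on span lines of the first ruling.\<close>

definition detached :: "nat \<Rightarrow> nat \<Rightarrow> (nat \<times> bool \<Rightarrow> 'a::field) \<Rightarrow> 'a \<Rightarrow> nat \<times> bool \<Rightarrow> 'a" where
  "detached M k w t = (\<lambda>(n, c). if n < 2 * M then w (n, c) else let i = n div 2 - M in
     if i < 2 * k then (if even n then w (i, c) + (if c then 0 else t) else w (2 * M + i, c))
     else if c then of_bool (odd n) else w (2 * M + i, False))"

lemma pt_detached:
  "n < 2 * M \<Longrightarrow> pt (detached M k w t) n = pt w n"
  "j < 2 * k \<Longrightarrow> pt (detached M k w t) (2 * (M + j)) = (w (j, False) + t, w (j, True))"
  "j < 2 * k \<Longrightarrow> pt (detached M k w t) (2 * (M + j) + 1) = pt w (2 * M + j)"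
  "2 * k \<le> i \<Longrightarrow> pt (detached M k w t) (2 * (M + i)) = (w (2 * M + i, False), 0)"
  "2 * k \<le> i \<Longrightarrow> pt (detached M k w t) (2 * (M + i) + 1) = (w (2 * M + i, False), 1)"
  by (simp_all add: detached_def pt_def)

lemma poly_fun_detached: "poly_fun (\<lambda>z :: 'v \<Rightarrow> 'a::field. detached M k w (z v) (n, c))"
  by (cases "n < 2 * M"; cases "n div 2 - M < 2 * k"; cases "even n"; cases c)
    (auto simp: detached_def Let_def intro: poly_fun.intros)

text \<open>The cofactor of \<open>t\<close> is polynomial in \<open>t\<close>, so the difference
  quotient makes sense at \<open>t = 0\<close>, where it is the derivative in the first
  coordinate.\<close>

lemma evalF_moved_point:
  fixes a b t :: "'a::field"
  shows "evalF d c (seg (a + t, b)) - evalF d c (seg (a, b)) =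
    t * (\<Sum>\<alpha>\<in>mons d. c \<alpha> * (b ^ (\<alpha> 1 + \<alpha> 3) * (\<Sum>q<\<alpha> 2 + \<alpha> 3. a ^ (\<alpha> 2 + \<alpha> 3 - Suc q) * (a + t) ^ q)))"
proof -
  let ?s = "\<lambda>n. \<Sum>q<n. a ^ (n - Suc q) * (a + t) ^ q"
  have pow: "(a + t) ^ n - a ^ n = t * ?s n" for n
    using power_diff_sumr2[of "a + t" n a] by simp
  have "(a + t) ^ n * b ^ m - a ^ n * b ^ m = t * (b ^ m * ?s n)" for n m
  proof -
    have "(a + t) ^ n * b ^ m - a ^ n * b ^ m = ((a + t) ^ n - a ^ n) * b ^ m"
      by (simp only: left_diff_distrib)
    then show ?thesis unfolding pow by (simp only: mult_ac)
  qed
  then have "mon (seg (a + t, b)) \<alpha> - mon (seg (a, b)) \<alpha> = t * (b ^ (\<alpha> 1 + \<alpha> 3) * ?s (\<alpha> 2 + \<alpha> 3))" for \<alpha>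
    by (simp only: mon_seg fst_conv snd_conv)
  then have "c \<alpha> * mon (seg (a + t, b)) \<alpha> - c \<alpha> * mon (seg (a, b)) \<alpha>
      = t * (c \<alpha> * (b ^ (\<alpha> 1 + \<alpha> 3) * ?s (\<alpha> 2 + \<alpha> 3)))" for \<alpha>
    by (simp only: right_diff_distrib[symmetric] mult.left_commute)
  then show ?thesis
    by (simp only: evalF_mon sum_subtractf[symmetric] sum_distrib_left)
qed

text \<open>Detach the pendant lines by moving their ends at the vertices \<open>j < 2 k\<close> along a ruling by t.
  The difference quotient of the values at the two ends is a condition which is polynomial in t and
  follows from the others if \<open>t \<noteq> 0\<close>; at \<open>t = 0\<close> it makes \<open>j\<close> a double point of the trace.\<close>
lemma matching_good_of_chains:
  fixes k M :: nat
  assumes k: "k \<ge> 1" and M: "2 * M = (k - 1) * (3 * k + 2) + 4"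
    and good: "\<exists>w :: nat \<times> bool \<Rightarrow> 'a::field_char_0. good (3 * k - 1) (chain_graph M k) w"
  shows "\<exists>w :: nat \<times> bool \<Rightarrow> 'a. good (3 * k + 1) (matching (M + 4 * k + 1)) w"
proof -
  \<comment> \<open>Layout of \<open>w\<close>: 2 M vertices of the matching, the first 2 k of them
    nodes; then 2 k free ends of pendant edges; then 2 k + 1 entries selecting ruling lines.\<close>
  let ?d = "3 * k + 1" and ?V = "{2 * M + 2 * k..<2 * M + 4 * k + 1}" and ?S = "{2 * k..<2 * M + 2 * k}"
  have "(k - 1) * 2 \<le> (k - 1) * (3 * k + 2)" by (intro mult_left_mono) auto
  then have kM: "k \<le> M" using M k by linarith
  have "\<exists>w :: nat \<times> bool \<Rightarrow> 'a. trace_good ?d ?V ?S {..<2 * k} {} w"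
    by (rule trace_good_double_points[OF k]) (use M kM in auto)
  then have gt: "generic (\<lambda>w :: nat \<times> bool \<Rightarrow> 'a. trace_good ?d ?V ?S {..<2 * k} {} w)"
    using trace_good_generic by blast
  have gg: "generic (\<lambda>w :: nat \<times> bool \<Rightarrow> 'a. good (3 * k - 1) (chain_graph M k) w)"
    using good good_generic by blast
  have gs: "generic (\<lambda>w :: nat \<times> bool \<Rightarrow> 'a. skew_edges (chain_graph M k) w)"
    by (rule skew_edges_generic[OF finite_chain_graph]) (use kM k in \<open>auto simp: chain_graph_def dest: matching_irrefl\<close>)
  \<comment> \<open>At each node the other ends of the two edges need different first coordinates,
    as \<open>double_point_of_trace\<close> requires.\<close>
  have gp: "generic (\<lambda>w :: nat \<times> bool \<Rightarrow> 'a. \<forall>j\<in>{..<2 * k}. w (2 * M + j, False) \<noteq> w (partner j, False))"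
  proof (intro generic_ball generic_distinct)
    fix j assume "j \<in> {..<2 * k}"
    then show "(2 * M + j, False) \<noteq> (partner j, False)" using partner_less[of j k] kM by auto
  qed simp
  obtain w :: "nat \<times> bool \<Rightarrow> 'a" where w: "trace_good ?d ?V ?S {..<2 * k} {} w"
    "good (3 * k - 1) (chain_graph M k) w" "skew_edges (chain_graph M k) w"
    "\<forall>j\<in>{..<2 * k}. w (2 * M + j, False) \<noteq> w (partner j, False)"
    using generic_witness[OF generic_conj[OF gt generic_conj[OF gg generic_conj[OF gs gp]]]] by blast
  let ?W = "detached M k w" and ?E = "matching (M + 4 * k + 1)"
  have E1: "(m, n) \<in> ?E" "m < 2 * M" "n < 2 * M" if "(m, n) \<in> matching M" for m n
    using that by (auto simp: matching_def)
  have E2: "(2 * (M + i), 2 * (M + i) + 1) \<in> ?E" if "i < 4 * k + 1" for i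
    unfolding matching_def by (rule image_eqI[of _ _ "M + i"]) (use that in auto)
  \<comment> \<open>Here \<open>w\<close> is fixed and the displacement \<open>z ()\<close> is the
    only variable. The second family of rows consists of the difference quotients.\<close>
  define R where "R = (\<lambda>((m, n), s, t) (z :: unit \<Rightarrow> 'a).
      mon (line_through (pt (?W (z ())) m) (pt (?W (z ())) n) s t)) ` (?E \<times> UNIV)
    \<union> (\<lambda>j z \<alpha>. w (j, True) ^ (\<alpha> 1 + \<alpha> 3) * (\<Sum>q<\<alpha> 2 + \<alpha> 3.
        w (j, False) ^ (\<alpha> 2 + \<alpha> 3 - Suc q) * (w (j, False) + z ()) ^ q)) ` {..<2 * k}"
  have R_iff: "(\<forall>r\<in>R. (\<Sum>\<alpha>\<in>mons ?d. c \<alpha> * r z \<alpha>) = 0) \<longleftrightarrow>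
      (\<forall>(m, n)\<in>?E. vanishes_on_line ?d c (pt (?W (z ())) m) (pt (?W (z ())) n)) \<and>
      (\<forall>j\<in>{..<2 * k}. (\<Sum>\<alpha>\<in>mons ?d. c \<alpha> * (w (j, True) ^ (\<alpha> 1 + \<alpha> 3) * (\<Sum>q<\<alpha> 2 + \<alpha> 3.
        w (j, False) ^ (\<alpha> 2 + \<alpha> 3 - Suc q) * (w (j, False) + z ()) ^ q))) = 0)" for c z
    unfolding R_def ball_Un ball_simps(9) by (simp add: vanishes_on_line_def evalF_mon split_def)
  have "\<exists>G. poly_fun G \<and> G (\<lambda>_. 0) \<noteq> 0 \<and> (\<forall>z. G z \<noteq> 0 \<longrightarrow>
    (\<forall>c\<in>forms ?d. (\<forall>r\<in>R. (\<Sum>\<alpha>\<in>mons ?d. c \<alpha> * r z \<alpha>) = 0) \<longrightarrow> c = (\<lambda>_. 0)))"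
  proof (rule forms_kernel_open)
    show "poly_fun (\<lambda>z. r z \<alpha>)" if "r \<in> R" for r \<alpha>
      using that unfolding R_def line_through_def
      by (elim UnE imageE)
        (auto intro!: poly_fun_mon poly_fun.intros poly_fun_sum poly_fun_power poly_fun_seg poly_fun_detached)
    fix c :: "(nat \<Rightarrow> nat) \<Rightarrow> 'a"
    assume c: "c \<in> forms ?d" and "\<And>r. r \<in> R \<Longrightarrow> (\<Sum>\<alpha>\<in>mons ?d. c \<alpha> * r (\<lambda>_. 0) \<alpha>) = 0"
    then have lines: "\<And>m n. (m, n) \<in> ?E \<Longrightarrow> vanishes_on_line ?d c (pt (?W 0) m) (pt (?W 0) n)"
      and deriv: "\<And>j. j < 2 * k \<Longrightarrow> (\<Sum>\<alpha>\<in>mons ?d. c \<alpha> * (w (j, True) ^ (\<alpha> 1 + \<alpha> 3) * (\<Sum>q<\<alpha> 2 + \<alpha> 3.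
        w (j, False) ^ (\<alpha> 2 + \<alpha> 3 - Suc q) * (w (j, False) + 0) ^ q))) = 0"
      using R_iff[of c "\<lambda>_. 0"] by auto
    let ?e = "quadric_trace ?d c"
    have L1: "vanishes_on_line ?d c (pt w m) (pt w n)" if "(m, n) \<in> matching M" for m n
      using lines[OF E1(1)[OF that]] E1(2,3)[OF that] by (simp add: pt_detached(1))
    have L2: "vanishes_on_line ?d c (pt w j) (pt w (2 * M + j))" if "j < 2 * k" for j
      using lines[OF E2[of j]] that pt_detached(2)[of j k M w 0] pt_detached(3)[of j k M w 0]
      by (simp add: pt_def)
    have L3: "biform ?d ?e (w (n, False), b) = 0" if "n \<in> ?V" for n b
    proof -
      define i where "i = n - 2 * M"
      have i: "2 * k \<le> i" "i < 4 * k + 1" "n = 2 * M + i" using that by (auto simp: i_def)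
      show ?thesis
        by (rule biform_ruling[OF lines[OF E2[OF i(2)]]]) (unfold pt_detached(4,5)[OF i(1)] i(3), simp_all)
    qed
    have chain: "vanishes_on_line ?d c (pt w m) (pt w n)" if "(m, n) \<in> chain_graph M k" for m n
      using that L1 L2 by (auto simp: chain_graph_def)
    have skew: "fst (pt w m) \<noteq> fst (pt w n)" "snd (pt w m) \<noteq> snd (pt w n)" if "(m, n) \<in> chain_graph M k" for m n
      using w(3) that by (auto simp: skew_edges_def)
    have "\<forall>i\<le>?d. \<forall>j\<le>?d. ?e i j = 0"
    proof (rule trace_goodD[OF w(1)])
      show "biform ?d ?e (pt w n) = 0" if "n \<in> ?S" for n
      proof (cases "n < 2 * M")
        case True
        then show ?thesis using matching_vertex[OF True L1] by (simp add: evalF_seg)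
      next
        case False
        then have "n = 2 * M + (n - 2 * M)" "n - 2 * M < 2 * k" using that by auto
        then show ?thesis using vanishes_on_lineD(2)[OF L2] by (metis evalF_seg)
      qed
      fix j assume "j \<in> {..<2 * k}"
      then have j: "j < 2 * k" by simp
      then have jM: "j < 2 * M" using kM by simp
      have "biform_da ?d ?e (pt w j) = 0"
      proof -
        have "(\<Sum>q<n. a ^ (n - Suc q) * (a + 0) ^ q) = of_nat n * a ^ (n - 1)" for n and a :: 'a
        proof -
          have "(\<Sum>q<n. a ^ (n - Suc q) * (a + 0) ^ q) = (\<Sum>q<n. a ^ (n - 1))"
            by (rule sum.cong) (auto simp: power_add[symmetric])
          then show ?thesis by simp
        qed
        then show ?thesis
          using deriv[OF j] by (simp add: sum_quadric_trace_da pt_def mult_ac)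
      qed
      moreover have "biform ?d ?e (pt w j) = 0"
        using vanishes_on_lineD(1)[OF L2[OF j]] by (simp add: evalF_seg)
      moreover have "biform_db ?d ?e (pt w j) = 0"
      proof (rule double_point_of_trace)
        have p: "(j, partner j) \<in> chain_graph M k \<or> (partner j, j) \<in> chain_graph M k"
          using matching_partner[OF jM] by (auto simp: chain_graph_def)
        then show "vanishes_on_line ?d c (pt w j) (pt w (partner j))"
          using chain vanishes_on_line_commute by blast
        show "vanishes_on_line ?d c (pt w j) (pt w (2 * M + j))" by (rule L2[OF j])
        show "snd (pt w (partner j)) \<noteq> snd (pt w j)" using p skew(2) by metis
        show "snd (pt w (2 * M + j)) \<noteq> snd (pt w j)"
          using skew(2)[of j "2 * M + j"] j by (auto simp: chain_graph_def)
        show "fst (pt w (partner j)) \<noteq> fst (pt w (2 * M + j))" using bspec[OF w(4), of j] j by (simp add: pt_def)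
      qed fact
      ultimately show "biform ?d ?e (pt w j) = 0 \<and> biform_da ?d ?e (pt w j) = 0 \<and> biform_db ?d ?e (pt w j) = 0"
        by blast
    qed (use L3 in auto)
    moreover have "?d - 2 = 3 * k - 1" by simp
    ultimately show "c = (\<lambda>_. 0)"
      using w(2) chain skew by (intro quadric_residual[OF c, where E = "chain_graph M k" and w = w]) auto
  qed
  then obtain G where G: "poly_fun G" "G (\<lambda>_. 0) \<noteq> 0" "\<forall>z. G z \<noteq> 0 \<longrightarrow>
    (\<forall>c\<in>forms ?d. (\<forall>r\<in>R. (\<Sum>\<alpha>\<in>mons ?d. c \<alpha> * r z \<alpha>) = 0) \<longrightarrow> c = (\<lambda>_. 0))" by blast
  obtain z where z: "G z \<noteq> 0" "z () \<noteq> 0"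
    using poly_fun_common_nonzero[OF G(1,2) pf_var[of "()"], of "\<lambda>_. 1"] by auto
  have "good ?d ?E (?W (z ()))"
    unfolding good_def
  proof (intro ballI impI)
    fix c :: "(nat \<Rightarrow> nat) \<Rightarrow> 'a"
    assume c: "c \<in> forms ?d" and lines: "\<forall>(m, n)\<in>?E. vanishes_on_line ?d c (pt (?W (z ())) m) (pt (?W (z ())) n)"
    have L1: "vanishes_on_line ?d c (pt w m) (pt w n)" if "(m, n) \<in> matching M" for m n
      using bspec[OF lines E1(1)[OF that]] E1(2,3)[OF that] by (simp add: pt_detached(1))
    \<comment> \<open>The displaced point and the node \<open>j\<close> both lie on lines of the
      matching, so both values vanish and the nonzero \<open>z ()\<close> cancels.\<close>
    have "(\<Sum>\<alpha>\<in>mons ?d. c \<alpha> * (w (j, True) ^ (\<alpha> 1 + \<alpha> 3) * (\<Sum>q<\<alpha> 2 + \<alpha> 3.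
        w (j, False) ^ (\<alpha> 2 + \<alpha> 3 - Suc q) * (w (j, False) + z ()) ^ q))) = 0" if j: "j < 2 * k" for j
    proof -
      have "vanishes_on_line ?d c (pt (?W (z ())) (2 * (M + j))) (pt (?W (z ())) (2 * (M + j) + 1))"
        using bspec[OF lines E2[of j]] j by simp
      from vanishes_on_lineD(1)[OF this]
      have "evalF ?d c (seg (w (j, False) + z (), w (j, True))) = 0" unfolding pt_detached(2)[OF j] .
      moreover have "evalF ?d c (seg (w (j, False), w (j, True))) = 0"
        using matching_vertex[of j M ?d c w] L1 j kM by (simp add: pt_def)
      ultimately show ?thesis
        using evalF_moved_point[of ?d c "w (j, False)" "z ()" "w (j, True)"] z(2) by simp
    qed
    then have "\<forall>r\<in>R. (\<Sum>\<alpha>\<in>mons ?d. c \<alpha> * r z \<alpha>) = 0" using lines R_iff by simp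
    then show "c = (\<lambda>_. 0)" using G(3) z(1) c by blast
  qed
  then show ?thesis by blast
qed

text \<open>The line counts are (d + 2)(d + 3)/6. Each family is obtained from the other one at the
  previous \<open>k\<close>, hence the simultaneous induction.\<close>

lemma matching_good:
  fixes k l :: nat
  shows "2 * l = (3 * k + 2) * (k + 1) \<Longrightarrow> \<exists>w :: nat \<times> bool \<Rightarrow> 'a::field_char_0. good (3 * k) (matching l) w"
    and "2 * l = (3 * k + 4) * (k + 1) \<Longrightarrow> \<exists>w :: nat \<times> bool \<Rightarrow> 'a. good (3 * k + 1) (matching l) w"
proof (induction k arbitrary: l)
  case 0
  {
    case 1
    then have "l = 1" by simp
    \<comment> \<open>In degrees 0 and 1 ruling lines fill all \<open>d + 1\<close> columns, so
      \<open>u = 0\<close>, and there is no residual problem.\<close>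
    then show ?case using add_ruling_lines[of 0 0 1 0, where 'a = 'a] by simp
  next
    case 2
    then have "l = 2" by simp
    then show ?case using add_ruling_lines[of 1 0 2 0, where 'a = 'a] by (simp add: numeral_2_eq_2)
  }
next
  case (Suc k)
  {
    case 1
    \<comment> \<open>2 k + 3 ruling lines leave k + 1 of the 3 k + 4 columns.\<close>
    define l' where "l' = l - (2 * k + 3)"
    have "(3 * Suc k + 2) * (Suc k + 1) = (3 * k + 4) * (k + 1) + 2 * (2 * k + 3)" by (simp add: algebra_simps)
    with 1 have l': "l = l' + (2 * k + 3)" "2 * l' = (3 * k + 4) * (k + 1)" by (auto simp: l'_def)
    have "(k + 1) * (3 * Suc k + 1) \<le> 2 * l'" unfolding l'(2) by (simp add: algebra_simps)
    then show ?case
      unfolding l'(1) using Suc.IH(2)[OF l'(2)]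
      by (intro add_ruling_lines[where u = "k + 1"]) (auto simp: numeral_eq_Suc)
  next
    case 2
    \<comment> \<open>4 k + 6 = 1 + (2 k + 2) + (2 k + 3): the extra edge of the chain step, the
      pendant lines, and the ruling lines in degree 3 k + 4.\<close>
    define l' where "l' = l - (4 * k + 6)"
    have "(3 * Suc k + 4) * (Suc k + 1) = (3 * k + 2) * (k + 1) + 2 * (4 * k + 6)" by (simp add: algebra_simps)
    with 2 have l': "l = l' + (4 * k + 6)" "2 * l' = (3 * k + 2) * (k + 1)" by (auto simp: l'_def)
    have "\<exists>w :: nat \<times> bool \<Rightarrow> 'a. good (3 * Suc k - 1) (chain_graph (l' + 1) (Suc k)) w"
      by (rule chain_graph_good) (use Suc.IH(1)[OF l'(2)] l'(2) in \<open>auto simp: algebra_simps\<close>)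
    from matching_good_of_chains[OF _ _ this] l'(2)
    have "\<exists>w :: nat \<times> bool \<Rightarrow> 'a. good (3 * Suc k + 1) (matching (l' + 1 + 4 * Suc k + 1)) w"
      by (simp add: algebra_simps)
    moreover have "l' + 1 + 4 * Suc k + 1 = l" using l'(1) by simp
    ultimately show ?case by metis
  }
qed

section \<open>Configurations in general position\<close>

text \<open>The factor \<open>f\<close> allows the powers of the four coordinates of a point on a
  line to be multiplied in one after another.\<close>

lemma linear_power_binary_form:
  fixes A B :: "'a::field"
  assumes "\<forall>s t. f s t = (\<Sum>j\<le>n. \<beta> j * s ^ j * t ^ (n - j))"
  shows "\<exists>\<gamma>. \<forall>s t. (s * A + t * B) ^ k * f s t = (\<Sum>j\<le>k + n. \<gamma> j * s ^ j * t ^ (k + n - j))"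
proof (induction k)
  case 0
  then show ?case using assms by auto
next
  case (Suc k)
  then obtain \<gamma> where \<gamma>: "\<And>s t. (s * A + t * B) ^ k * f s t = (\<Sum>j\<le>k + n. \<gamma> j * s ^ j * t ^ (k + n - j))"
    by blast
  let ?N = "k + n"
  \<comment> \<open>Coefficients with index outside 0, ..., \<open>?N\<close> count as zero.\<close>
  define \<delta> where "\<delta> j = (if j = 0 then 0 else A * \<gamma> (j - 1)) + (if j \<le> ?N then B * \<gamma> j else 0)" for j
  have "(s * A + t * B) ^ Suc k * f s t = (\<Sum>j\<le>Suc ?N. \<delta> j * s ^ j * t ^ (Suc ?N - j))" for s t
  proof -
    have "(\<Sum>j\<le>Suc ?N. \<delta> j * s ^ j * t ^ (Suc ?N - j)) =
        (\<Sum>j\<le>Suc ?N. (if j = 0 then 0 else A * \<gamma> (j - 1)) * s ^ j * t ^ (Suc ?N - j))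
      + (\<Sum>j\<le>Suc ?N. (if j \<le> ?N then B * \<gamma> j else 0) * s ^ j * t ^ (Suc ?N - j))"
      by (simp only: \<delta>_def distrib_right sum.distrib)
    also have "(\<Sum>j\<le>Suc ?N. (if j = 0 then 0 else A * \<gamma> (j - 1)) * s ^ j * t ^ (Suc ?N - j))
      = s * A * (\<Sum>j\<le>?N. \<gamma> j * s ^ j * t ^ (?N - j))"
      by (subst sum.atMost_Suc_shift) (simp add: sum_distrib_left mult_ac)
    also have "(\<Sum>j\<le>Suc ?N. (if j \<le> ?N then B * \<gamma> j else 0) * s ^ j * t ^ (Suc ?N - j))
      = (\<Sum>j\<le>?N. B * \<gamma> j * s ^ j * t ^ (Suc ?N - j))"
      by simp
    also have "\<dots> = t * B * (\<Sum>j\<le>?N. \<gamma> j * s ^ j * t ^ (?N - j))"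
      unfolding sum_distrib_left by (rule sum.cong) (simp_all add: Suc_diff_le mult_ac)
    finally show ?thesis unfolding \<gamma>[symmetric] by (simp only: power_Suc mult.assoc distrib_right)
  qed
  then show ?case by (metis add_Suc)
qed

lemma mon_line_vec:
  fixes z :: "pvar \<Rightarrow> 'a::field"
  assumes "\<alpha> \<in> mons d"
  shows "\<exists>\<beta>. \<forall>s t. mon (line_vec z i s t) \<alpha> = (\<Sum>j\<le>d. \<beta> j * s ^ j * t ^ (d - j))"
proof -
  let ?L = "\<lambda>m s t. s * z (VA i m) + t * z (VB i m)"
  have "\<forall>s t :: 'a. 1 = (\<Sum>j\<le>0. 1 * s ^ j * t ^ (0 - j))" by simp
  from linear_power_binary_form[OF this, where A = "z (VA i 3)" and B = "z (VB i 3)" and k = "\<alpha> 3"]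
  obtain \<beta>3 where "\<forall>s t. ?L 3 s t ^ \<alpha> 3 * 1 = (\<Sum>j\<le>\<alpha> 3 + 0. \<beta>3 j * s ^ j * t ^ (\<alpha> 3 + 0 - j))" by blast
  from linear_power_binary_form[OF this, where A = "z (VA i 2)" and B = "z (VB i 2)" and k = "\<alpha> 2"]
  obtain \<beta>2 where "\<forall>s t. ?L 2 s t ^ \<alpha> 2 * (?L 3 s t ^ \<alpha> 3 * 1)
    = (\<Sum>j\<le>\<alpha> 2 + (\<alpha> 3 + 0). \<beta>2 j * s ^ j * t ^ (\<alpha> 2 + (\<alpha> 3 + 0) - j))" by blast
  from linear_power_binary_form[OF this, where A = "z (VA i 1)" and B = "z (VB i 1)" and k = "\<alpha> 1"]
  obtain \<beta>1 where "\<forall>s t. ?L 1 s t ^ \<alpha> 1 * (?L 2 s t ^ \<alpha> 2 * (?L 3 s t ^ \<alpha> 3 * 1))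
    = (\<Sum>j\<le>\<alpha> 1 + (\<alpha> 2 + (\<alpha> 3 + 0)). \<beta>1 j * s ^ j * t ^ (\<alpha> 1 + (\<alpha> 2 + (\<alpha> 3 + 0)) - j))" by blast
  from linear_power_binary_form[OF this, where A = "z (VA i 0)" and B = "z (VB i 0)" and k = "\<alpha> 0"]
  obtain \<beta>0 where 0: "\<forall>s t. ?L 0 s t ^ \<alpha> 0 * (?L 1 s t ^ \<alpha> 1 * (?L 2 s t ^ \<alpha> 2 * (?L 3 s t ^ \<alpha> 3 * 1)))
    = (\<Sum>j\<le>\<alpha> 0 + (\<alpha> 1 + (\<alpha> 2 + (\<alpha> 3 + 0))).
        \<beta>0 j * s ^ j * t ^ (\<alpha> 0 + (\<alpha> 1 + (\<alpha> 2 + (\<alpha> 3 + 0))) - j))" by blast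
  have d: "\<alpha> 0 + (\<alpha> 1 + (\<alpha> 2 + (\<alpha> 3 + 0))) = d" using assms by (simp add: mons_iff)
  show ?thesis
    using 0 unfolding d by (intro exI[of _ \<beta>0]) (simp add: mon_eq line_vec_def mult.assoc)
qed

definition determined :: "nat \<Rightarrow> nat \<Rightarrow> nat \<Rightarrow> (pvar \<Rightarrow> 'a::field) \<Rightarrow> bool" where
  "determined d l p z \<longleftrightarrow> (\<forall>c\<in>forms d. (\<forall>i<l. \<forall>s t. evalF d c (line_vec z i s t) = 0) \<longrightarrow>
     (\<forall>j<p. evalF d c (point_vec z j) = 0) \<longrightarrow> c = (\<lambda>_. 0))"

text \<open>An injective linear map between spaces of equal dimension. The target consists of
  functions, so the square system is set up in coefficients of binary forms, with
  \<open>d + 1\<close> equations for each line and one for each point.\<close>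

lemma restr_map_bij:
  fixes z :: "pvar \<Rightarrow> 'a::field"
  assumes det: "determined d l p z" and card: "l * (d + 1) + p = card (mons d)"
  shows "bij_betw (restr_map d l p z) (forms d) (restr_target d l p)"
proof -
  \<comment> \<open>A choice of coefficients for the restriction of each monomial to line
    \<open>i\<close>; these are the matrix entries.\<close>
  define \<kappa> where "\<kappa> i \<alpha> =
    (SOME \<beta>. \<forall>s t. mon (line_vec z i s t) \<alpha> = (\<Sum>j\<le>d. \<beta> j * s ^ j * t ^ (d - j)))" for i \<alpha>
  have \<kappa>: "mon (line_vec z i s t) \<alpha> = (\<Sum>j\<le>d. \<kappa> i \<alpha> j * s ^ j * t ^ (d - j))"
    if "\<alpha> \<in> mons d" for i \<alpha> s t
    using someI_ex[OF mon_line_vec[OF that, of z i]] unfolding \<kappa>_def by blast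
  define K where "K c i j = (\<Sum>\<alpha>\<in>mons d. \<kappa> i \<alpha> j * c \<alpha>)" for c i j
  have line: "evalF d c (line_vec z i s t) = (\<Sum>j\<le>d. K c i j * s ^ j * t ^ (d - j))" for c i s t
  proof -
    have "evalF d c (line_vec z i s t) = (\<Sum>\<alpha>\<in>mons d. \<Sum>j\<le>d. \<kappa> i \<alpha> j * c \<alpha> * s ^ j * t ^ (d - j))"
      unfolding evalF_mon by (rule sum.cong) (simp_all add: \<kappa> sum_distrib_left mult_ac)
    also have "\<dots> = (\<Sum>j\<le>d. K c i j * s ^ j * t ^ (d - j))"
      unfolding K_def sum_distrib_right by (rule sum.swap)
    finally show ?thesis .
  qed
  have inj: "inj_on (restr_map d l p z) (forms d)"
  proof (rule inj_onI)
    fix c c' :: "(nat \<Rightarrow> nat) \<Rightarrow> 'a"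
    assume c: "c \<in> forms d" "c' \<in> forms d" and eq: "restr_map d l p z c = restr_map d l p z c'"
    have "evalF d c (line_vec z i s t) = evalF d c' (line_vec z i s t)" if "i < l" for i s t
      using fun_cong[OF fun_cong[OF arg_cong[OF eq, of fst], of i], of "(s, t)"] that
      by (simp add: restr_map_def)
    moreover have "evalF d c (point_vec z j) = evalF d c' (point_vec z j)" if "j < p" for j
      using fun_cong[OF arg_cong[OF eq, of snd], of j] that by (simp add: restr_map_def)
    ultimately have "(\<lambda>\<alpha>. c \<alpha> - c' \<alpha>) = (\<lambda>_. 0)"
      using det forms_diff[OF c] unfolding determined_def by (simp add: evalF_diff)
    then show "c = c'" by (auto simp: fun_eq_iff)
  qed
  have maps: "restr_map d l p z c \<in> restr_target d l p" for c
    by (auto simp: restr_map_def restr_target_def binforms_def line)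
  have surj: "\<exists>c\<in>forms d. restr_map d l p z c = (g, v)" if gv: "(g, v) \<in> restr_target d l p" for g v
  proof -
    have "\<forall>i\<in>{..<l}. \<exists>\<beta>. g i = (\<lambda>(s, t). \<Sum>j\<le>d. \<beta> j * s ^ j * t ^ (d - j))"
      using gv by (auto simp: restr_target_def binforms_def)
    from bchoice[OF this] obtain \<beta> where
      \<beta>: "\<forall>i\<in>{..<l}. g i = (\<lambda>(s, t). \<Sum>j\<le>d. \<beta> i j * s ^ j * t ^ (d - j))" by blast
    define I where "I = ({..<l} \<times> {..d}) <+> {..<p}"
    define r where "r x \<alpha> = (case x of Inl (i, j) \<Rightarrow> \<kappa> i \<alpha> j | Inr j \<Rightarrow> mon (point_vec z j) \<alpha>)" for x \<alpha>
    define b where "b x = (case x of Inl (i, j) \<Rightarrow> \<beta> i j | Inr j \<Rightarrow> v j)" for x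
    have "finite I" "card I = card (mons d)"
      using card by (simp_all add: I_def card_Plus card_cartesian_product)
    moreover have "trivial_kernel (r ` I) (mons d)"
      unfolding trivial_kernel_def
    proof (intro allI impI)
      fix c assume c: "\<forall>q\<in>r ` I. (\<Sum>\<alpha>\<in>mons d. q \<alpha> * c \<alpha>) = 0"
      let ?c = "\<lambda>\<alpha>. if \<alpha> \<in> mons d then c \<alpha> else 0"
      have restrict: "(\<Sum>\<alpha>\<in>mons d. q \<alpha> * ?c \<alpha>) = (\<Sum>\<alpha>\<in>mons d. q \<alpha> * c \<alpha>)" for q :: "(nat \<Rightarrow> nat) \<Rightarrow> 'a"
        by (rule sum.cong) simp_all
      have "K ?c i j = 0" if "i < l" "j \<le> d" for i j
      proof -
        have "Inl (i, j) \<in> I" using that by (auto simp: I_def)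
        from bspec[OF c imageI[OF this]] show ?thesis unfolding K_def restrict by (simp add: r_def)
      qed
      then have "evalF d ?c (line_vec z i s t) = 0" if "i < l" for i s t
        using that by (simp add: line)
      moreover have "evalF d ?c (point_vec z j) = 0" if "j < p" for j
      proof -
        have "evalF d ?c (point_vec z j) = (\<Sum>\<alpha>\<in>mons d. r (Inr j) \<alpha> * ?c \<alpha>)"
          by (simp add: evalF_mon r_def mult.commute)
        also have "\<dots> = 0" unfolding restrict using c that by (auto simp: I_def)
        finally show ?thesis .
      qed
      moreover have "?c \<in> forms d" by (simp add: forms_def)
      ultimately have "?c = (\<lambda>_. 0)" using det unfolding determined_def by blast
      then show "\<forall>\<alpha>\<in>mons d. c \<alpha> = 0" by (auto simp: fun_eq_iff split: if_splits)
    qed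
    ultimately obtain c where c: "\<And>x. x \<in> I \<Longrightarrow> (\<Sum>\<alpha>\<in>mons d. r x \<alpha> * c \<alpha>) = b x"
      using trivial_kernel_surjective[OF finite_mons, of I d r b] by blast
    let ?c = "\<lambda>\<alpha>. if \<alpha> \<in> mons d then c \<alpha> else 0"
    have restrict: "(\<Sum>\<alpha>\<in>mons d. q \<alpha> * ?c \<alpha>) = (\<Sum>\<alpha>\<in>mons d. q \<alpha> * c \<alpha>)" for q :: "(nat \<Rightarrow> nat) \<Rightarrow> 'a"
      by (rule sum.cong) simp_all
    have "K ?c i j = \<beta> i j" if "i < l" "j \<le> d" for i j
      using c[of "Inl (i, j)"] that unfolding K_def restrict by (simp add: r_def b_def I_def InlI)
    then have "evalF d ?c (line_vec z i s t) = g i (s, t)" if "i < l" for i s t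
      using that by (simp add: line \<beta>)
    moreover have "evalF d ?c (point_vec z j) = v j" if "j < p" for j
    proof -
      have "evalF d ?c (point_vec z j) = (\<Sum>\<alpha>\<in>mons d. r (Inr j) \<alpha> * ?c \<alpha>)"
        by (simp add: evalF_mon r_def mult.commute)
      also have "\<dots> = v j" unfolding restrict using c[of "Inr j"] that by (simp add: I_def b_def InrI)
      finally show ?thesis .
    qed
    ultimately have "restr_map d l p z ?c = (g, v)"
      using gv by (auto simp: restr_map_def restr_target_def fun_eq_iff)
    moreover have "?c \<in> forms d" by (simp add: forms_def)
    ultimately show ?thesis by blast
  qed
  show ?thesis
    unfolding bij_betw_def
  proof (intro conjI equalityI subsetI inj)
    fix y assume "y \<in> restr_map d l p z ` forms d"
    then show "y \<in> restr_target d l p" using maps by blast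
  next
    fix y :: "(nat \<Rightarrow> 'a \<times> 'a \<Rightarrow> 'a) \<times> (nat \<Rightarrow> 'a)"
    assume "y \<in> restr_target d l p"
    then obtain c where "c \<in> forms d" "restr_map d l p z c = y" using surj[of "fst y" "snd y"] by auto
    then show "y \<in> restr_map d l p z ` forms d" by blast
  qed
qed

lemma determined_generic:
  fixes z0 :: "pvar \<Rightarrow> 'a::field"
  assumes "determined d l p z0"
  shows "generic (\<lambda>z :: pvar \<Rightarrow> 'a. determined d l p z)"
proof -
  define R where "R = (\<lambda>(i, s, t) (z :: pvar \<Rightarrow> 'a). mon (line_vec z i s t)) ` ({..<l} \<times> UNIV)
    \<union> (\<lambda>j z. mon (point_vec z j)) ` {..<p}"
  have R_iff: "(\<forall>r\<in>R. (\<Sum>\<alpha>\<in>mons d. c \<alpha> * r z \<alpha>) = 0) \<longleftrightarrow>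
    (\<forall>i<l. \<forall>s t. evalF d c (line_vec z i s t) = 0) \<and> (\<forall>j<p. evalF d c (point_vec z j) = 0)" for c z
    unfolding R_def ball_Un ball_simps(9) by (auto simp: evalF_mon)
  have eq: "determined d l p z \<longleftrightarrow>
      (\<forall>c\<in>forms d. (\<forall>r\<in>R. (\<Sum>\<alpha>\<in>mons d. c \<alpha> * r z \<alpha>) = 0) \<longrightarrow> c = (\<lambda>_. 0))" for z
    by (simp only: determined_def R_iff imp_conjL)
  have "\<exists>G. poly_fun G \<and> G z0 \<noteq> 0 \<and> (\<forall>z. G z \<noteq> 0 \<longrightarrow>
    (\<forall>c\<in>forms d. (\<forall>r\<in>R. (\<Sum>\<alpha>\<in>mons d. c \<alpha> * r z \<alpha>) = 0) \<longrightarrow> c = (\<lambda>_. 0)))"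
  proof (rule forms_kernel_open)
    show "poly_fun (\<lambda>z. r z \<alpha>)" if "r \<in> R" for r \<alpha>
      using that unfolding R_def
      by (elim UnE imageE) (auto simp: line_vec_def point_vec_def intro!: poly_fun_mon poly_fun.intros)
    show "c = (\<lambda>_. 0)" if "c \<in> forms d" "\<And>r. r \<in> R \<Longrightarrow> (\<Sum>\<alpha>\<in>mons d. c \<alpha> * r z0 \<alpha>) = 0" for c
      using assms that unfolding eq by blast
  qed
  then show ?thesis unfolding generic_def eq by blast
qed

lemma determined_of_quadric_points:
  fixes w :: "nat \<times> bool \<Rightarrow> 'a::field"
  assumes w: "\<And>c. c \<in> forms d \<Longrightarrow>
      (\<And>i. i < l \<Longrightarrow> vanishes_on_line d c (pt w (2 * i)) (pt w (2 * i + 1))) \<Longrightarrow>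
      (\<And>j. j < p \<Longrightarrow> evalF d c (seg (of_nat j, 0)) = 0) \<Longrightarrow> c = (\<lambda>_. 0)"
  shows "\<exists>z :: pvar \<Rightarrow> 'a. determined d l p z"
proof -
  \<comment> \<open>L_0 is the line of the quadric with second coordinate 0, where (1 - j) seg (0,
    0) + j seg (1, 0) = seg (j, 0). This special position is allowed because one witness
    suffices.\<close>
  define z :: "pvar \<Rightarrow> 'a" where "z v = (case v of
      VA i m \<Rightarrow> seg (pt w (2 * i)) m | VB i m \<Rightarrow> seg (pt w (2 * i + 1)) m
    | VC m \<Rightarrow> seg (0, 0) m | VE m \<Rightarrow> seg (1, 0) m | VU j \<Rightarrow> 1 - of_nat j | VV j \<Rightarrow> of_nat j)" for v
  have "line_vec z i s t = line_through (pt w (2 * i)) (pt w (2 * i + 1)) s t" for i s t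
    by (simp add: line_vec_def line_through_def z_def)
  moreover have "point_vec z j = seg (of_nat j, 0)" for j
    by (rule ext) (simp add: point_vec_def z_def seg_def)
  ultimately have "determined d l p z"
    unfolding determined_def using w by (auto simp: vanishes_on_line_def)
  then show ?thesis by blast
qed

lemma six_times_choose_3: "6 * ((d + 3) choose 3) = (d + 1) * (d + 2) * (d + 3)"
proof -
  have 3: "Suc 2 * (Suc (d + 2) choose Suc 2) = Suc (d + 2) * ((d + 2) choose 2)"
    by (rule Suc_times_binomial)
  have 2: "Suc 1 * (Suc (d + 1) choose Suc 1) = Suc (d + 1) * ((d + 1) choose 1)"
    by (rule Suc_times_binomial)
  have 1: "(d + 1) choose 1 = d + 1" by simp
  have "Suc 2 = 3" "Suc (d + 2) = d + 3" "Suc 1 = 2" "Suc (d + 1) = d + 2" by simp_all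
  then have eqs: "3 * ((d + 3) choose 3) = (d + 3) * ((d + 2) choose 2)" "2 * ((d + 2) choose 2) = (d + 2) * (d + 1)"
    using 2 3 by (simp_all only: 1)
  have "6 * ((d + 3) choose 3) = 2 * (3 * ((d + 3) choose 3))" by simp
  also have "\<dots> = (d + 3) * (2 * ((d + 2) choose 2))" unfolding eqs(1) by (simp only: mult.left_commute)
  also have "\<dots> = (d + 3) * ((d + 2) * (d + 1))" unfolding eqs(2) ..
  finally show ?thesis by (simp only: mult_ac)
qed

theorem theorem2p2:
  fixes k \<epsilon> d l p :: nat
  assumes "\<epsilon> \<le> 2" and "d = 3 * k + \<epsilon>" and "d \<ge> 1"
    and "l = ((3 * k + 5 + 2 * \<epsilon>) * k) div 2 + 1 + \<epsilon>"
    and "p = (if \<epsilon> = 2 then k + 1 else 0)"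
  shows "general (\<lambda>z :: pvar \<Rightarrow> 'a::alg_closed_char0.
           bij_betw (restr_map d l p z) (forms d) (restr_target d l p))"
proof -
  \<comment> \<open>The two factors have opposite parity, so the division by 2 in \<open>l\<close>
    is exact.\<close>
  have "even ((3 * k + 5 + 2 * \<epsilon>) * k)" by simp
  then have l2: "2 * l = (3 * k + 5 + 2 * \<epsilon>) * k + 2 * (1 + \<epsilon>)" using assms(4) by simp
  consider (0) "\<epsilon> = 0" | (1) "\<epsilon> = 1" | (2) "\<epsilon> = 2" using assms(1) by linarith
  then have "(\<exists>z :: pvar \<Rightarrow> 'a. determined d l p z) \<and> 6 * (l * (d + 1) + p) = (d + 1) * (d + 2) * (d + 3)"
  proof cases
    case 0
    then have l: "2 * l = (3 * k + 2) * (k + 1)" "d = 3 * k" "p = 0"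
      using l2 assms(2,5) by (simp_all add: algebra_simps)
    obtain w :: "nat \<times> bool \<Rightarrow> 'a" where w: "good d (matching l) w"
      using matching_good(1)[OF l(1)] l(2) by blast
    have "\<exists>z :: pvar \<Rightarrow> 'a. determined d l p z"
      by (rule determined_of_quadric_points[of _ _ w]) (use w in \<open>auto simp: good_def matching_def\<close>)
    moreover have "6 * (l * (d + 1) + p) = 3 * (2 * l) * (d + 1)" by (simp add: l(3))
    then have "6 * (l * (d + 1) + p) = (d + 1) * (d + 2) * (d + 3)"
      unfolding l(1) by (simp add: l(2) algebra_simps)
    ultimately show ?thesis by blast
  next
    case 1
    then have l: "2 * l = (3 * k + 4) * (k + 1)" "d = 3 * k + 1" "p = 0"
      using l2 assms(2,5) by (simp_all add: algebra_simps)
    obtain w :: "nat \<times> bool \<Rightarrow> 'a" where w: "good d (matching l) w"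
      using matching_good(2)[OF l(1)] l(2) by blast
    have "\<exists>z :: pvar \<Rightarrow> 'a. determined d l p z"
      by (rule determined_of_quadric_points[of _ _ w]) (use w in \<open>auto simp: good_def matching_def\<close>)
    moreover have "6 * (l * (d + 1) + p) = 3 * (2 * l) * (d + 1)" by (simp add: l(3))
    then have "6 * (l * (d + 1) + p) = (d + 1) * (d + 2) * (d + 3)"
      unfolding l(1) by (simp add: l(2) algebra_simps)
    ultimately show ?thesis by blast
  next
    case 2
    define l' where "l' = l - (2 * k + 2)"
    have "2 * l = (3 * k + 2) * (k + 1) + 2 * (2 * k + 2)" using l2 2 by (simp add: algebra_simps)
    then have l: "l = l' + (2 * k + 2)" "2 * l' = (3 * k + 2) * (k + 1)" by (auto simp: l'_def)
    have d: "d = 3 * k + 2" "p = k + 1" using 2 assms(2,5) by simp_all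
    \<comment> \<open>The k + 1 columns left by 2 k + 2 ruling lines need (k + 1)(3 k + 3) points,
      but the chords supply (3 k + 2)(k + 1). The missing k + 1 points form the bottom row of the
      grid and are therefore collinear.\<close>
    let ?K = "{..<k + 1} \<times> {0 :: nat}"
    have "{..<k + 1} \<times> {..d} - ?K = {..<k + 1} \<times> {1..d}" by auto
    then have card: "card ({..<k + 1} \<times> {..d} - ?K) \<le> 2 * l'"
      unfolding l(2) by (simp add: card_cartesian_product d algebra_simps)
    have "\<exists>w :: nat \<times> bool \<Rightarrow> 'a. good (d - 2) (matching l') w"
      using matching_good(1)[OF l(2)] d by simp
    from add_ruling_lines_and_points[OF disjI2[OF this] _ card, of "2 * k + 2"]
    obtain w :: "nat \<times> bool \<Rightarrow> 'a" where w: "\<And>c. c \<in> forms d \<Longrightarrow>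
      \<forall>(m, n)\<in>matching l. vanishes_on_line d c (pt w m) (pt w n) \<Longrightarrow>
      \<forall>P\<in>nat_point ` ?K. evalF d c (seg P) = 0 \<Longrightarrow> c = (\<lambda>_. 0)"
      using d l(1) by auto
    have "\<exists>z :: pvar \<Rightarrow> 'a. determined d l p z"
      by (rule determined_of_quadric_points[of _ _ w], rule w) (auto simp: matching_def d)
    moreover have "6 * (l * (d + 1) + p) = 3 * (2 * l') * (d + 1) + 6 * (2 * k + 2) * (d + 1) + 6 * p"
      unfolding l(1) by (simp add: algebra_simps)
    then have "6 * (l * (d + 1) + p) = (d + 1) * (d + 2) * (d + 3)"
      unfolding l(2) d by (simp add: algebra_simps)
    ultimately show ?thesis by blast
  qed
  then obtain z :: "pvar \<Rightarrow> 'a" where z: "determined d l p z"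
    and count: "6 * (l * (d + 1) + p) = (d + 1) * (d + 2) * (d + 3)" by blast
  have "l * (d + 1) + p = card (mons d)"
    using count six_times_choose_3[of d] by (simp add: card_mons)
  then have "bij_betw (restr_map d l p z) (forms d) (restr_target d l p)" if "determined d l p z"
    for z :: "pvar \<Rightarrow> 'a"
    using restr_map_bij that by blast
  then show ?thesis
    using determined_generic[OF z] unfolding general_def generic_def by blast
qed

end
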